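(* Let $G$ be a non-trivial finite group and $n\ge 0$ an integer. Suppose that for all finite free $G$-simplicial complexes $\mathcal{K}_1,\mathcal{K}_2$ with $\operatorname{xind}\mathcal{F}(\mathcal{K}_1)=\operatorname{xind}\mathcal{F}(\mathcal{K}_2)=n$ one has $\operatorname{xind}(\mathcal{F}(\mathcal{K}_1)\times\mathcal{F}(\mathcal{K}_2))=n$. Then for all finite free $G$-simplicial complexes $\mathcal{K}_1,\mathcal{K}_2$ with $\operatorname{ind}\mathcal{K}_1=\operatorname{ind}\mathcal{K}_2=n$ one has $\operatorname{ind}(\mathcal{K}_1\times\mathcal{K}_2)=n$.
   Context: For a space $X$ with a free $G$-action, $\operatorname{ind}X$ is the minimal $k\ge0$ such that there is a continuous $G$-equivariant map $X\to E_kG=G^{*(k+1)}$ (the $(k+1)$-fold join of discrete $G$). Products of $G$-spaces carry the diagonal action. A $G$-poset is a poset with an order-preserving $G$-action; a $G$-map between $G$-posets is an order-preserving $G$-equivariant map. For $n\ge0$, $Q_nG$ is the $G$-poset on $G\times\{0,\dots,n\}$ with action $g\cdot(h,i)=(gh,i)$ and order $(g,i)\prec(h,j)$ iff $i<j$. The cross-index $\operatorname{xind}P$ of a $G$-poset $P$ is the smallest $n$ such that there is a $G$-map $P\to Q_nG$. The face poset $\mathcal{F}(\mathcal{K})$ of a simplicial complex is the set of its non-empty simplices ordered by inclusion, with the induced $G$-action. The product $P\times Q$ of posets has the componentwise order and, for $G$-posets, the diagonal action. *)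

theory Defs
  imports "HOL-Analysis.Analysis" "HOL-Algebra.Group_Action" "HOL-Library.Extended_Nat"
begin

text \<open>
  Objects with an action are bundled with an action function whose values are relevant only for
  group elements in the carrier and for points of the object.
\<close>

record ('g, 'a) gposet =
  elems :: "'a set"
  le :: "'a \<Rightarrow> 'a \<Rightarrow> bool"
  pact :: "'g \<Rightarrow> 'a \<Rightarrow> 'a"

record ('g, 'a) gspace =
  space_top :: "'a topology"
  sact :: "'g \<Rightarrow> 'a \<Rightarrow> 'a"

record ('g, 'v) gcomplex =
  simps :: "'v set set"
  vact :: "'g \<Rightarrow> 'v \<Rightarrow> 'v"

definition free_on :: "('g, 'm) monoid_scheme \<Rightarrow> 'a set \<Rightarrow> ('g \<Rightarrow> 'a \<Rightarrow> 'a) \<Rightarrow> bool" where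
  "free_on G X \<phi> \<longleftrightarrow> (\<forall>g\<in>carrier G. \<forall>x\<in>X. \<phi> g x = x \<longrightarrow> g = \<one>\<^bsub>G\<^esub>)"

definition equivariant_on ::
    "('g, 'm) monoid_scheme \<Rightarrow> 'a set \<Rightarrow> ('g \<Rightarrow> 'a \<Rightarrow> 'a) \<Rightarrow> ('g \<Rightarrow> 'b \<Rightarrow> 'b) \<Rightarrow> ('a \<Rightarrow> 'b) \<Rightarrow> bool" where
  "equivariant_on G X \<phi> \<psi> f \<longleftrightarrow> (\<forall>g\<in>carrier G. \<forall>x\<in>X. f (\<phi> g x) = \<psi> g (f x))"


section \<open>G-posets and the cross-index\<close>

definition gposet_map ::
    "('g, 'm) monoid_scheme \<Rightarrow> ('g, 'a) gposet \<Rightarrow> ('g, 'b) gposet \<Rightarrow> ('a \<Rightarrow> 'b) \<Rightarrow> bool" where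
  "gposet_map G P Q f \<longleftrightarrow>
     f \<in> elems P \<rightarrow> elems Q \<and> monotone_on (elems P) (le P) (le Q) f \<and>
     equivariant_on G (elems P) (pact P) (pact Q) f"

definition prod_gposet :: "('g, 'a) gposet \<Rightarrow> ('g, 'b) gposet \<Rightarrow> ('g, 'a \<times> 'b) gposet" where
  "prod_gposet P Q =
     \<lparr>elems = elems P \<times> elems Q,
      le = (\<lambda>(p, q) (p', q'). le P p p' \<and> le Q q q'),
      pact = (\<lambda>g (p, q). (pact P g p, pact Q g q))\<rparr>"

definition Q_gposet :: "('g, 'm) monoid_scheme \<Rightarrow> nat \<Rightarrow> ('g, 'g \<times> nat) gposet" where
  "Q_gposet G n =
     \<lparr>elems = carrier G \<times> {..n},
      le = (\<lambda>(g, i) (h, j). (g, i) = (h, j) \<or> i < j),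
      pact = (\<lambda>g (h, i). (g \<otimes>\<^bsub>G\<^esub> h, i))\<rparr>"

text \<open>The cross-index is \<open>\<infinity>\<close> when there is no map at all; likewise for the index below.\<close>

definition xind :: "('g, 'm) monoid_scheme \<Rightarrow> ('g, 'a) gposet \<Rightarrow> enat" where
  "xind G P = Inf {enat n | n. \<exists>f. gposet_map G P (Q_gposet G n) f}"


section \<open>Simplicial complexes and their geometric realizations\<close>

text \<open>
  A complex is given by its set of non-empty simplices; its vertex set is the union of the
  simplices.
\<close>

definition simplicial_complex :: "'v set set \<Rightarrow> bool" where
  "simplicial_complex K \<longleftrightarrow>
     (\<forall>\<sigma>\<in>K. finite \<sigma> \<and> \<sigma> \<noteq> {}) \<and> (\<forall>\<sigma>\<in>K. \<forall>\<tau>. \<tau> \<noteq> {} \<and> \<tau> \<subseteq> \<sigma> \<longrightarrow> \<tau> \<in> K)"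

text \<open>
  Points of the realization are systems of barycentric coordinates. The ambient function space
  carries the product topology; for finite complexes, the only ones considered, the subspace
  topology is the usual one.
\<close>

definition realization :: "'v set set \<Rightarrow> ('v \<Rightarrow> real) set" where
  "realization K = {x. (\<forall>v. 0 \<le> x v) \<and> {v. x v \<noteq> 0} \<in> K \<and> (\<Sum>v | x v \<noteq> 0. x v) = 1}"

text \<open>The affine extension of a vertex map sends \<open>\<Sum> x\<^sub>v v\<close> to \<open>\<Sum> x\<^sub>v f(v)\<close>.\<close>

definition affine_ext :: "('v \<Rightarrow> 'w) \<Rightarrow> ('v \<Rightarrow> real) \<Rightarrow> ('w \<Rightarrow> real)" where
  "affine_ext f x = (\<lambda>w. \<Sum>v | x v \<noteq> 0 \<and> f v = w. x v)"

definition realization_gspace :: "('g, 'v) gcomplex \<Rightarrow> ('g, 'v \<Rightarrow> real) gspace" where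
  "realization_gspace K =
     \<lparr>space_top = top_of_set (realization (simps K)), sact = (\<lambda>g. affine_ext (vact K g))\<rparr>"

text \<open>
  The restriction is needed because the library's group actions are extensional functions.
\<close>

definition G_complex :: "('g, 'm) monoid_scheme \<Rightarrow> ('g, 'v) gcomplex \<Rightarrow> bool" where
  "G_complex G K \<longleftrightarrow>
     simplicial_complex (simps K) \<and>
     group_action G (\<Union>(simps K)) (\<lambda>g. restrict (vact K g) (\<Union>(simps K))) \<and>
     (\<forall>g\<in>carrier G. \<forall>\<sigma>\<in>simps K. vact K g ` \<sigma> \<in> simps K)"

text \<open>
  Freeness refers to the points of the realization: no non-trivial group element may map a simplex
  to itself, even if it moves all its vertices.
\<close>

definition finite_free_G_complex :: "('g, 'm) monoid_scheme \<Rightarrow> ('g, 'v) gcomplex \<Rightarrow> bool" where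
  "finite_free_G_complex G K \<longleftrightarrow>
     G_complex G K \<and> finite (simps K) \<and>
     free_on G (realization (simps K)) (sact (realization_gspace K))"

definition face_gposet :: "('g, 'v) gcomplex \<Rightarrow> ('g, 'v set) gposet" where
  "face_gposet K = \<lparr>elems = simps K, le = (\<subseteq>), pact = (\<lambda>g \<sigma>. vact K g ` \<sigma>)\<rparr>"


section \<open>G-spaces and the index\<close>

definition gspace_map ::
    "('g, 'm) monoid_scheme \<Rightarrow> ('g, 'a) gspace \<Rightarrow> ('g, 'b) gspace \<Rightarrow> ('a \<Rightarrow> 'b) \<Rightarrow> bool" where
  "gspace_map G X Y f \<longleftrightarrow>
     continuous_map (space_top X) (space_top Y) f \<and>
     equivariant_on G (topspace (space_top X)) (sact X) (sact Y) f"

definition prod_gspace :: "('g, 'a) gspace \<Rightarrow> ('g, 'b) gspace \<Rightarrow> ('g, 'a \<times> 'b) gspace" where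
  "prod_gspace X Y =
     \<lparr>space_top = prod_topology (space_top X) (space_top Y),
      sact = (\<lambda>g (x, y). (sact X g x, sact Y g y))\<rparr>"

text \<open>
  The \<open>(k+1)\<close>-fold simplicial join of \<open>K\<close>: the copies of \<open>K\<close> are indexed by \<open>0, \<dots>, k\<close>, and a
  simplex is the disjoint union of one possibly empty simplex from each copy. Its realization is
  the \<open>(k+1)\<close>-fold topological join of the realization of \<open>K\<close> if \<open>K\<close> is finite.
\<close>

definition join_power :: "('g, 'v) gcomplex \<Rightarrow> nat \<Rightarrow> ('g, 'v \<times> nat) gcomplex" where
  "join_power K k =
     \<lparr>simps = {\<sigma>. \<sigma> \<noteq> {} \<and> \<sigma> \<subseteq> UNIV \<times> {..k} \<and>
                  (\<forall>i\<le>k. {v. (v, i) \<in> \<sigma>} = {} \<or> {v. (v, i) \<in> \<sigma>} \<in> simps K)},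
      vact = (\<lambda>g (v, i). (vact K g v, i))\<rparr>"

definition discrete_gcomplex :: "('g, 'm) monoid_scheme \<Rightarrow> ('g, 'g) gcomplex" where
  "discrete_gcomplex G = \<lparr>simps = {{h} | h. h \<in> carrier G}, vact = (\<lambda>g h. g \<otimes>\<^bsub>G\<^esub> h)\<rparr>"

definition E_gspace :: "('g, 'm) monoid_scheme \<Rightarrow> nat \<Rightarrow> ('g, 'g \<times> nat \<Rightarrow> real) gspace" where
  "E_gspace G k = realization_gspace (join_power (discrete_gcomplex G) k)"

definition ind :: "('g, 'm) monoid_scheme \<Rightarrow> ('g, 'a) gspace \<Rightarrow> enat" where
  "ind G X = Inf {enat k | k. \<exists>f. gspace_map G X (E_gspace G k) f}"

end

theory Submission
  imports Defs
begin

text \<open>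
  The projection to a factor gives \<open>ind (K1 \<times> K2) \<le> n\<close>. For the lower bound, let \<open>L1\<close> and \<open>L2\<close> be
  iterated subdivisions of \<open>K1\<close> and \<open>K2\<close>. A \<open>G\<close>-map from the face poset of \<open>L\<close> to \<open>Q\<^sub>k G\<close> sends chains to
  simplices of \<open>E\<^sub>k G\<close> and therefore induces an equivariant continuous map from \<open>|L|\<close> to \<open>E\<^sub>k G\<close>, so
  the cross-index of \<open>Li\<close> is at least \<open>ind Ki = n\<close>. Conversely, an equivariant map from \<open>|K|\<close> to \<open>E\<^sub>k G\<close>
  gives, once the subdivision \<open>L\<close> is so fine that the map oscillates by less than \<open>1 / (k + 1)\<close> on
  each simplex, a \<open>G\<close>-map to \<open>Q\<^sub>k G\<close>: send a simplex to the vertex \<open>(g, i)\<close> of largest level \<open>i\<close> whose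
  coordinate reaches \<open>1 / (k + 1)\<close> somewhere on it. The same works for products of simplices, without
  triangulating the product. For fine subdivisions the cross-indices of \<open>L1\<close> and \<open>L2\<close> are thus \<open>n\<close>, and
  a map from \<open>|K1| \<times> |K2|\<close> to \<open>E\<^sub>k G\<close> with \<open>k < n\<close> would contradict the hypothesis on \<open>L1\<close> and \<open>L2\<close>.
\<close>

section \<open>Simplicial actions\<close>

abbreviation verts :: "('g, 'v) gcomplex \<Rightarrow> 'v set" where
  "verts K \<equiv> \<Union>(simps K)"

text \<open>The element \<open>inv g\<close> provides the inverse permutation; restricting to
  \<open>S\<close> makes every map extensional, as \<open>Bij S\<close> demands.\<close>

lemma group_actionI:
  assumes "group G"
    and closed: "\<And>g x. g \<in> carrier G \<Longrightarrow> x \<in> S \<Longrightarrow> \<phi> g x \<in> S"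
    and one: "\<And>x. x \<in> S \<Longrightarrow> \<phi> \<one>\<^bsub>G\<^esub> x = x"
    and mult: "\<And>g h x. g \<in> carrier G \<Longrightarrow> h \<in> carrier G \<Longrightarrow> x \<in> S \<Longrightarrow>
                 \<phi> (g \<otimes>\<^bsub>G\<^esub> h) x = \<phi> g (\<phi> h x)"
  shows "group_action G S (\<lambda>g. restrict (\<phi> g) S)"
proof -
  interpret group G by fact
  have bij: "restrict (\<phi> g) S \<in> Bij S" if g: "g \<in> carrier G" for g
  proof -
    have "bij_betw (\<phi> g) S S"
      by (rule bij_betw_byWitness[where f' = "\<phi> (inv\<^bsub>G\<^esub> g)"])
        (use g closed mult[symmetric] one in auto)
    then show ?thesis
      by (auto simp: Bij_def)
  qed
  have "restrict (\<phi> (g \<otimes>\<^bsub>G\<^esub> h)) S = compose S (restrict (\<phi> g) S) (restrict (\<phi> h) S)"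
    if "g \<in> carrier G" "h \<in> carrier G" for g h
    using that by (auto simp: compose_def mult closed fun_eq_iff)
  then have "(\<lambda>g. restrict (\<phi> g) S) \<in> hom G (BijGroup S)"
    using bij by (auto simp: hom_def BijGroup_def)
  then show ?thesis
    by (auto simp: group_action_def group_hom_def group_hom_axioms_def group_BijGroup assms(1))
qed

lemma simplicial_complexD:
  assumes "simplicial_complex K" "\<sigma> \<in> K"
  shows "finite \<sigma>" "\<sigma> \<noteq> {}" "\<And>\<tau>. \<tau> \<subseteq> \<sigma> \<Longrightarrow> \<tau> \<noteq> {} \<Longrightarrow> \<tau> \<in> K"
proof -
  have K: "\<forall>\<sigma>\<in>K. finite \<sigma> \<and> \<sigma> \<noteq> {}" "\<forall>\<sigma>\<in>K. \<forall>\<tau>. \<tau> \<noteq> {} \<and> \<tau> \<subseteq> \<sigma> \<longrightarrow> \<tau> \<in> K"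
    using assms(1) unfolding simplicial_complex_def by - (elim conjE, assumption)+
  show "finite \<sigma>" "\<sigma> \<noteq> {}"
    using bspec[OF K(1) assms(2)] by simp_all
  show "\<tau> \<in> K" if "\<tau> \<subseteq> \<sigma>" "\<tau> \<noteq> {}" for \<tau>
    by (rule bspec[OF K(2) assms(2), rule_format]) (simp add: that)
qed

lemma G_complex_simplicial: "G_complex G K \<Longrightarrow> simplicial_complex (simps K)"
  unfolding G_complex_def by (rule conjunct1)

lemmas G_complex_simplexD = simplicial_complexD[OF G_complex_simplicial]

lemma G_complex_image_simp:
  "G_complex G K \<Longrightarrow> g \<in> carrier G \<Longrightarrow> \<sigma> \<in> simps K \<Longrightarrow> vact K g ` \<sigma> \<in> simps K"
  by (simp add: G_complex_def)

lemma vact_closed: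
  assumes "G_complex G K" "g \<in> carrier G" "v \<in> verts K"
  shows "vact K g v \<in> verts K"
proof -
  obtain \<sigma> where \<sigma>: "\<sigma> \<in> simps K" "v \<in> \<sigma>"
    using assms(3) by blast
  show ?thesis
    using G_complex_image_simp[OF assms(1,2) \<sigma>(1)] \<sigma>(2) by (rule UnionI[OF _ imageI])
qed

lemma vact_one:
  assumes "G_complex G K" "v \<in> verts K"
  shows "vact K \<one>\<^bsub>G\<^esub> v = v"
proof -
  interpret group_action G "verts K" "\<lambda>g. restrict (vact K g) (verts K)"
    using assms(1) unfolding G_complex_def by blast
  show ?thesis
    using fun_cong[OF id_eq_one, of v] assms(2) by simp
qed

lemma vact_mult:
  assumes "G_complex G K" "v \<in> verts K" "g \<in> carrier G" "h \<in> carrier G"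
  shows "vact K (g \<otimes>\<^bsub>G\<^esub> h) v = vact K g (vact K h v)"
proof -
  interpret group_action G "verts K" "\<lambda>g. restrict (vact K g) (verts K)"
    using assms(1) unfolding G_complex_def by blast
  show ?thesis
    using composition_rule[OF assms(2-4)] assms(2) vact_closed[OF assms(1,4,2)] by simp
qed

lemma vact_inv:
  assumes "group G" "G_complex G K" "v \<in> verts K" "g \<in> carrier G"
  shows "vact K (inv\<^bsub>G\<^esub> g) (vact K g v) = v" "vact K g (vact K (inv\<^bsub>G\<^esub> g) v) = v"
proof -
  interpret group G by fact
  show "vact K (inv\<^bsub>G\<^esub> g) (vact K g v) = v" "vact K g (vact K (inv\<^bsub>G\<^esub> g) v) = v"
    using assms vact_mult[OF assms(2,3), symmetric] vact_one[OF assms(2,3)] by simp_all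
qed

lemma vact_bij:
  assumes "group G" "G_complex G K" "g \<in> carrier G"
  shows "bij_betw (vact K g) (verts K) (verts K)"
  by (rule bij_betw_byWitness[where f' = "vact K (inv\<^bsub>G\<^esub> g)"])
    (use assms vact_inv[OF assms(1,2) _ assms(3)] vact_closed[OF assms(2)]
      group.inv_closed[OF assms(1,3)] in blast)+

lemma vact_inj:
  assumes "group G" "G_complex G K" "g \<in> carrier G" "\<sigma> \<subseteq> verts K"
  shows "inj_on (vact K g) \<sigma>"
  using bij_betw_imp_inj_on[OF vact_bij[OF assms(1-3)]] assms(4) by (rule inj_on_subset)

lemma image_vact_inv:
  assumes "group G" "G_complex G K" "\<sigma> \<subseteq> verts K" "g \<in> carrier G"
  shows "vact K (inv\<^bsub>G\<^esub> g) ` vact K g ` \<sigma> = \<sigma>" "vact K g ` vact K (inv\<^bsub>G\<^esub> g) ` \<sigma> = \<sigma>"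
  unfolding image_image
  using vact_inv[OF assms(1,2) _ assms(4)] assms(3) by (auto simp: subset_iff image_iff)

text \<open>Serves to reindex sums over all simplices by a group element.\<close>

lemma simps_bij:
  assumes "group G" "G_complex G K" "g \<in> carrier G"
  shows "bij_betw ((`) (vact K g)) (simps K) (simps K)"
proof (rule bij_betw_byWitness[where f' = "(`) (vact K (inv\<^bsub>G\<^esub> g))"])
  show "\<forall>\<sigma>\<in>simps K. vact K (inv\<^bsub>G\<^esub> g) ` vact K g ` \<sigma> = \<sigma>"
    "\<forall>\<sigma>\<in>simps K. vact K g ` vact K (inv\<^bsub>G\<^esub> g) ` \<sigma> = \<sigma>"
    using image_vact_inv[OF assms(1,2) _ assms(3)] by (auto simp: Sup_upper)
  show "(`) (vact K g) ` simps K \<subseteq> simps K" "(`) (vact K (inv\<^bsub>G\<^esub> g)) ` simps K \<subseteq> simps K"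
    using G_complex_image_simp[OF assms(2)] assms(3) group.inv_closed[OF assms(1,3)] by blast+
qed


section \<open>Affine extensions and points of the realization\<close>

text \<open>Replaces the index set by a finite one that does not vary with \<open>x\<close> and
  \<open>w\<close>, so that sums can be interchanged.\<close>

lemma affine_ext_sum:
  assumes "finite S" "{v. x v \<noteq> 0} \<subseteq> S"
  shows "affine_ext a x w = (\<Sum>v\<in>S. if a v = w then x v else 0)"
proof -
  have "affine_ext a x w = (\<Sum>v\<in>{v\<in>S. a v = w}. x v)"
    unfolding affine_ext_def
    by (rule sum.mono_neutral_left) (use assms in auto)
  then show ?thesis
    using assms(1) by (simp add: sum.If_cases Int_def conj_commute)
qed

lemma affine_ext_apply:
  assumes "inj_on a S" "{v. x v \<noteq> 0} \<subseteq> S" "v \<in> S"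
  shows "affine_ext a x (a v) = x v"
proof -
  have "{u. x u \<noteq> 0 \<and> a u = a v} = (if x v = 0 then {} else {v})"
    using assms by (auto dest: inj_onD)
  then show ?thesis
    by (simp add: affine_ext_def)
qed

lemma affine_ext_outside:
  assumes "w \<notin> a ` {v. x v \<noteq> 0}"
  shows "affine_ext a x w = 0"
proof -
  have "{u. x u \<noteq> 0 \<and> a u = w} = {}"
    using assms by auto
  then show ?thesis
    by (simp only: affine_ext_def sum.empty)
qed

lemma affine_ext_eqI:
  assumes "bij_betw a S S" "{v. x v \<noteq> 0} \<subseteq> S"
    and "\<And>v. v \<in> S \<Longrightarrow> z (a v) = x v" "\<And>v. v \<notin> S \<Longrightarrow> z v = 0"
  shows "affine_ext a x = z"
proof
  fix w
  show "affine_ext a x w = z w"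
  proof (cases "w \<in> S")
    case True
    then obtain v where "v \<in> S" "w = a v"
      using assms(1) unfolding bij_betw_def by blast
    then show ?thesis
      using affine_ext_apply[OF bij_betw_imp_inj_on[OF assms(1)] assms(2)] assms(3) by simp
  next
    case False
    then have "w \<notin> a ` {v. x v \<noteq> 0}"
      using assms(1,2) unfolding bij_betw_def by blast
    then show ?thesis
      using False assms(4) by (simp add: affine_ext_outside)
  qed
qed

text \<open>Coordinates with sum 1 force a non-empty support, which is then a face of any simplex
  containing it; so the support need not be known exactly.\<close>

lemma realizationI:
  assumes "simplicial_complex K" "\<And>v. 0 \<le> x v" "\<tau> \<in> K" "{v. x v \<noteq> 0} \<subseteq> \<tau>" "(\<Sum>v\<in>\<tau>. x v) = 1"
  shows "x \<in> realization K"
proof -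
  have fin: "finite \<tau>"
    by (rule simplicial_complexD(1)[OF assms(1,3)])
  have sum: "(\<Sum>v | x v \<noteq> 0. x v) = (\<Sum>v\<in>\<tau>. x v)"
    by (rule sum.mono_neutral_left) (use fin assms(4) in auto)
  then have "{v. x v \<noteq> 0} \<noteq> {}"
    using assms(5) by (metis sum.empty zero_neq_one)
  then have "{v. x v \<noteq> 0} \<in> K"
    by (rule simplicial_complexD(3)[OF assms(1,3,4)])
  then show ?thesis
    unfolding realization_def using assms(2,5) sum by auto
qed

lemma realization_sum:
  assumes "x \<in> realization K" "{v. x v \<noteq> 0} \<subseteq> S" "finite S"
  shows "(\<Sum>v\<in>S. x v) = 1"
proof -
  have "(\<Sum>v | x v \<noteq> 0. x v) = (\<Sum>v\<in>S. x v)"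
    by (rule sum.mono_neutral_left) (use assms in auto)
  then show ?thesis
    using assms(1) by (simp add: realization_def)
qed

lemma realization_support: "x \<in> realization K \<Longrightarrow> {v. x v \<noteq> 0} \<in> K"
  and realization_nonneg: "x \<in> realization K \<Longrightarrow> 0 \<le> x v"
  by (auto simp: realization_def)

lemma topspace_realization [simp]:
  "topspace (space_top (realization_gspace K)) = realization (simps K)"
  by (simp add: realization_gspace_def)

lemma realization_gspace_sel [simp]:
  "space_top (realization_gspace K) = top_of_set (realization (simps K))"
  "sact (realization_gspace K) = (\<lambda>g. affine_ext (vact K g))"
  by (simp_all add: realization_gspace_def)

section \<open>Compactness of the realization, and invariant simplices of free actions\<close>

text \<open>The realization is a closed subset of a cube of functions into [0, 1], which is compact
  by Tychonoff's theorem for every vertex type.\<close>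

lemma compact_realization:
  fixes K :: "'v set set"
  assumes "finite K" "simplicial_complex K"
  shows "compact (realization K)"
proof -
  have finV: "finite (\<Union>K)"
    using assms(1) simplicial_complexD(1)[OF assms(2)] by blast
  have "compactin (product_topology (\<lambda>_::'v. euclideanreal) UNIV) (PiE UNIV (\<lambda>_. {0..1}))"
    by (simp add: compactin_PiE)
  then have box: "compact (PiE UNIV (\<lambda>_::'v. {0..1::real}))"
    by (simp add: euclidean_product_topology)
  have coord: "continuous_on UNIV (\<lambda>x::'v \<Rightarrow> real. x v)" for v
    by simp
  have "closed {x::'v \<Rightarrow> real. \<forall>v\<in>- \<sigma>. x v = 0}" for \<sigma>
  proof -
    have "{x::'v \<Rightarrow> real. \<forall>v\<in>- \<sigma>. x v = 0} = (\<Inter>v\<in>- \<sigma>. {x. x v = 0})"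
      by auto
    then show ?thesis
      by (auto intro!: closed_INT closed_Collect_eq coord continuous_on_const)
  qed
  then have cl1: "closed (\<Union>\<sigma>\<in>K. {x::'v \<Rightarrow> real. \<forall>v\<in>- \<sigma>. x v = 0})"
    using assms(1) by (intro closed_UN) auto
  have cl2: "closed {x::'v \<Rightarrow> real. (\<Sum>v\<in>\<Union>K. x v) = 1}"
    by (intro closed_Collect_eq continuous_on_sum coord continuous_on_const)
  \<comment> \<open>Summing over the fixed finite vertex set instead of the support turns the
    normalization into a closed condition.\<close>
  have "realization K = PiE UNIV (\<lambda>_. {0..1}) \<inter>
      ((\<Union>\<sigma>\<in>K. {x. \<forall>v\<in>- \<sigma>. x v = 0}) \<inter> {x. (\<Sum>v\<in>\<Union>K. x v) = 1})" (is "_ = ?R")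
  proof (intro subset_antisym subsetI)
    fix x assume x: "x \<in> realization K"
    have supp: "{v. x v \<noteq> 0} \<subseteq> \<Union>K"
      using realization_support[OF x] by blast
    have sum: "(\<Sum>v\<in>\<Union>K. x v) = 1"
      by (rule realization_sum[OF x supp finV])
    have "x v \<le> 1" for v
    proof (cases "v \<in> \<Union>K")
      case True
      then show ?thesis
        using sum member_le_sum[of v "\<Union>K" x] realization_nonneg[OF x] finV by simp
    next
      case False
      then have "x v = 0"
        using supp by blast
      then show ?thesis
        by simp
    qed
    then show "x \<in> ?R"
      using realization_support[OF x] realization_nonneg[OF x] sum by auto
  next
    fix x assume x: "x \<in> ?R"
    then obtain \<sigma> where \<sigma>: "\<sigma> \<in> K" "\<forall>v\<in>- \<sigma>. x v = 0"
      by blast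
    have "(\<Sum>v\<in>\<sigma>. x v) = (\<Sum>v\<in>\<Union>K. x v)"
      by (rule sum.mono_neutral_left) (use \<sigma> finV in auto)
    then show "x \<in> realization K"
      using x \<sigma> by (intro realizationI[OF assms(2), of _ \<sigma>]) (auto simp: PiE_iff)
  qed
  then show ?thesis
    using box cl1 cl2 by (simp add: compact_Int_closed closed_Int)
qed

text \<open>An invariant simplex has a fixed barycentre, to which freeness on the realization
  applies.\<close>

lemma free_simplexD:
  assumes "group G" "finite_free_G_complex G K" "g \<in> carrier G" "\<sigma> \<in> simps K" "vact K g ` \<sigma> = \<sigma>"
  shows "g = \<one>\<^bsub>G\<^esub>"
proof -
  have K: "G_complex G K"
    using assms(2) by (simp add: finite_free_G_complex_def)
  define x where "x = (\<lambda>v. if v \<in> \<sigma> then 1 / real (card \<sigma>) else 0)"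
  have fin: "finite \<sigma>" "\<sigma> \<noteq> {}"
    using G_complex_simplexD[OF K assms(4)] by simp_all
  then have x: "x \<in> realization (simps K)"
    by (intro realizationI[OF G_complex_simplicial[OF K] _ assms(4)]) (auto simp: x_def)
  have "affine_ext (vact K g) x = x"
  proof (rule affine_ext_eqI)
    show "bij_betw (vact K g) \<sigma> \<sigma>"
      using vact_inj[OF assms(1) K assms(3)] assms(4,5) by (auto simp: bij_betw_def)
    qed (use assms(5) in \<open>auto simp: x_def\<close>)
  then show ?thesis
    using assms(2,3) x by (auto simp: finite_free_G_complex_def free_on_def)
qed

section \<open>Barycentric subdivision\<close>

text \<open>
  The vertices of the subdivision are codes \<open>e \<sigma>\<close> of the simplices of \<open>K\<close>, so that iterated
  subdivisions can be kept inside one vertex type.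
\<close>

definition subdivision :: "('v set \<Rightarrow> 'w) \<Rightarrow> ('g, 'v) gcomplex \<Rightarrow> ('g, 'w) gcomplex" where
  "subdivision e K =
     \<lparr>simps = {e ` C | C. C \<noteq> {} \<and> C \<subseteq> simps K \<and> chain_subset C},
      vact = (\<lambda>g m. e (vact K g ` inv_into (simps K) e m))\<rparr>"

lemma chain_subset_mono: "chain_subset C \<Longrightarrow> D \<subseteq> C \<Longrightarrow> chain_subset D"
  unfolding chain_subset_def by blast

lemma chain_subset_image:
  assumes "chain_subset C"
  shows "chain_subset ((`) f ` C)"
  using assms unfolding chain_subset_def by (simp add: ball_simps) (meson image_mono)

text \<open>The union of a finite non-empty chain is one of its members.\<close>

lemma chain_subset_top:
  assumes "chain_subset C" "finite C" "C \<noteq> {}"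
  obtains \<tau> where "\<tau> \<in> C" "\<And>\<sigma>. \<sigma> \<in> C \<Longrightarrow> \<sigma> \<subseteq> \<tau>"
proof -
  have "\<Union>C \<in> C"
    using assms(2,3,1)
  proof (induction C rule: finite_ne_induct)
    case (insert \<sigma> C)
    then have "\<Union>C \<in> C"
      using chain_subset_mono by blast
    then have "\<sigma> \<subseteq> \<Union>C \<or> \<Union>C \<subseteq> \<sigma>"
      using insert.prems unfolding chain_subset_def by blast
    then have "\<Union>(insert \<sigma> C) = \<Union>C \<or> \<Union>(insert \<sigma> C) = \<sigma>"
      by auto
    then show ?case
      using \<open>\<Union>C \<in> C\<close> by auto
  qed simp
  then show ?thesis
    using that by blast
qed

locale coded_complex = group G for G :: "('g, 'm) monoid_scheme" (structure) +
  fixes K :: "('g, 'v) gcomplex" and e :: "'v set \<Rightarrow> 'w"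
  assumes K: "finite_free_G_complex G K" and e: "inj_on e (simps K)"
begin

abbreviation sd :: "('g, 'w) gcomplex" where
  "sd \<equiv> subdivision e K"

lemma is_group: "group G" ..

lemma K_complex: "G_complex G K" and K_finite: "finite (simps K)"
  using K by (simp_all add: finite_free_G_complex_def)

lemma simps_sd: "simps sd = {e ` C | C. C \<noteq> {} \<and> C \<subseteq> simps K \<and> chain_subset C}"
  by (simp add: subdivision_def)

lemma decode: "\<sigma> \<in> simps K \<Longrightarrow> inv_into (simps K) e (e \<sigma>) = \<sigma>"
  using e by (rule inv_into_f_f)

lemma vact_sd: "\<sigma> \<in> simps K \<Longrightarrow> vact sd g (e \<sigma>) = e (vact K g ` \<sigma>)"
  by (simp add: subdivision_def decode)

lemma verts_sd: "verts sd = e ` simps K"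
proof
  show "verts sd \<subseteq> e ` simps K"
    by (auto simp: simps_sd)
  show "e ` simps K \<subseteq> verts sd"
  proof
    fix m assume "m \<in> e ` simps K"
    then obtain \<sigma> where "\<sigma> \<in> simps K" "m = e \<sigma>"
      by blast
    then have "{m} \<in> simps sd"
      unfolding simps_sd by (intro CollectI exI[of _ "{\<sigma>}"]) (auto simp: chain_subset_def)
    then show "m \<in> verts sd"
      by blast
  qed
qed

lemma simplicial_complex_sd: "simplicial_complex (simps sd)"
  unfolding simplicial_complex_def
proof (intro conjI ballI allI impI)
  fix s assume "s \<in> simps sd"
  then obtain C where C: "s = e ` C" "C \<noteq> {}" "C \<subseteq> simps K" "chain_subset C"
    unfolding simps_sd by blast
  show "finite s" "s \<noteq> {}"
    using C finite_subset[OF C(3) K_finite] by auto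
  fix t assume t: "t \<noteq> {} \<and> t \<subseteq> s"
  then obtain D where D: "D \<subseteq> C" "t = e ` D"
    unfolding C(1) by (elim conjE subset_imageE)
  have "D \<noteq> {}" "D \<subseteq> simps K" "chain_subset D"
    using t D C(3) chain_subset_mono[OF C(4) D(1)] by auto
  then show "t \<in> simps sd"
    unfolding simps_sd D(2) by (intro CollectI exI[of _ D] conjI refl)
qed

lemma G_complex_sd: "G_complex G sd"
  unfolding G_complex_def
proof (intro conjI ballI simplicial_complex_sd)
  have vK: "\<sigma> \<subseteq> verts K" if "\<sigma> \<in> simps K" for \<sigma>
    using that by (rule Union_upper)
  show "group_action G (verts sd) (\<lambda>g. restrict (vact sd g) (verts sd))"
  proof (rule group_actionI[OF is_group])
    fix m assume "m \<in> verts sd"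
    then obtain \<sigma> where \<sigma>: "\<sigma> \<in> simps K" "m = e \<sigma>"
      unfolding verts_sd by blast
    have v: "v \<in> verts K" if "v \<in> \<sigma>" for v
      using vK[OF \<sigma>(1)] that by (rule subsetD)
    show "vact sd g m \<in> verts sd" if "g \<in> carrier G" for g
      unfolding verts_sd \<sigma>(2) vact_sd[OF \<sigma>(1)]
      by (rule imageI[OF G_complex_image_simp[OF K_complex that \<sigma>(1)]])
    have "vact K \<one> ` \<sigma> = id ` \<sigma>"
      by (rule image_cong) (simp_all add: vact_one[OF K_complex v])
    then show "vact sd \<one> m = m"
      unfolding \<sigma>(2) vact_sd[OF \<sigma>(1)] by simp
    fix g h assume gh: "g \<in> carrier G" "h \<in> carrier G"
    have "vact K (g \<otimes> h) ` \<sigma> = vact K g ` (vact K h ` \<sigma>)"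
      unfolding image_image by (rule image_cong) (simp_all add: vact_mult[OF K_complex v gh])
    then show "vact sd (g \<otimes> h) m = vact sd g (vact sd h m)"
      unfolding \<sigma>(2) vact_sd[OF \<sigma>(1)] vact_sd[OF G_complex_image_simp[OF K_complex gh(2) \<sigma>(1)]]
      by simp
  qed
  fix g s assume g: "g \<in> carrier G" and "s \<in> simps sd"
  then obtain C where C: "s = e ` C" "C \<noteq> {}" "C \<subseteq> simps K" "chain_subset C"
    unfolding simps_sd by blast
  have eq: "vact sd g ` s = e ` ((`) (vact K g) ` C)"
    unfolding C(1) image_image using C(3) by (intro image_cong refl) (simp add: vact_sd subset_iff)
  have "(`) (vact K g) ` C \<subseteq> simps K"
    using C(3) G_complex_image_simp[OF K_complex g] by blast
  then show "vact sd g ` s \<in> simps sd"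
    unfolding simps_sd eq using C(2) chain_subset_image[OF C(4)]
    by (intro CollectI exI[of _ "(`) (vact K g) ` C"] conjI refl) simp_all
qed

lemma finite_simps_sd: "finite (simps sd)"
proof (rule finite_subset)
  show "simps sd \<subseteq> (`) e ` Pow (simps K)"
    unfolding simps_sd by blast
qed (simp add: K_finite)

text \<open>The support of a fixed point codes a chain that \<open>g\<close> permutes. Its largest
  member \<tau> is the translate of some member \<sigma> \<subseteq> \<tau> of the same cardinality,
  so \<sigma> = \<tau> is an invariant simplex of \<open>K\<close>, and freeness of \<open>K\<close>
  applies.\<close>

lemma free_sd: "finite_free_G_complex G sd"
  unfolding finite_free_G_complex_def free_on_def
proof (intro conjI G_complex_sd finite_simps_sd ballI impI)
  fix g x assume g: "g \<in> carrier G" and x: "x \<in> realization (simps sd)"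
    and stab: "sact (realization_gspace sd) g x = x"
  from realization_support[OF x] obtain C
    where C: "{m. x m \<noteq> 0} = e ` C" "C \<noteq> {}" "C \<subseteq> simps K" "chain_subset C"
    unfolding simps_sd by blast
  have fin: "finite C"
    using C(3) K_finite by (rule finite_subset)
  obtain \<tau> where \<tau>: "\<tau> \<in> C" "\<And>\<sigma>. \<sigma> \<in> C \<Longrightarrow> \<sigma> \<subseteq> \<tau>"
    using chain_subset_top[OF C(4) fin C(2)] by blast
  have \<tau>K: "\<tau> \<in> simps K"
    using \<tau>(1) C(3) by blast
  have "affine_ext (vact sd g) x (e \<tau>) \<noteq> 0"
    using stab C(1) \<tau>(1) by auto
  then have "e \<tau> \<in> vact sd g ` {m. x m \<noteq> 0}"
    by (rule contrapos_np) (rule affine_ext_outside)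
  then obtain \<sigma> where \<sigma>: "\<sigma> \<in> C" "e \<tau> = vact sd g (e \<sigma>)"
    unfolding C(1) by blast
  have \<sigma>K: "\<sigma> \<in> simps K"
    using \<sigma>(1) C(3) by blast
  have eq: "\<tau> = vact K g ` \<sigma>"
    using \<sigma>(2) unfolding vact_sd[OF \<sigma>K]
    by (rule inj_onD[OF e _ \<tau>K G_complex_image_simp[OF K_complex g \<sigma>K]])
  have "card \<tau> = card \<sigma>"
    unfolding eq by (rule card_image[OF vact_inj[OF is_group K_complex g Union_upper[OF \<sigma>K]]])
  then have "\<sigma> = \<tau>"
    by (intro card_subset_eq[OF G_complex_simplexD(1)[OF K_complex \<tau>K] \<tau>(2)[OF \<sigma>(1)]]) simp
  then show "g = \<one>"
    using free_simplexD[OF is_group K g \<sigma>K] eq by simp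
qed

end


section \<open>Maps out of a realization induced by maps on chains of simplices\<close>

text \<open>
  The weight of \<open>\<sigma>\<close> is positive iff \<open>\<sigma>\<close> is a superlevel set \<open>{v. t \<le> x v}\<close> with \<open>t > 0\<close>, so
  the simplices of positive weight form a chain. Normalized weights play the role of barycentric
  coordinates of \<open>x\<close> in the subdivision, although the resulting map to the subdivision is not the
  usual homeomorphism.
\<close>

definition weight :: "('g, 'v) gcomplex \<Rightarrow> ('v \<Rightarrow> real) \<Rightarrow> 'v set \<Rightarrow> real" where
  "weight K x \<sigma> = (\<Prod>v\<in>\<sigma>. x v) * (\<Prod>v\<in>\<sigma>. \<Prod>w\<in>verts K - \<sigma>. max 0 (x v - x w))"

lemma weight_nonneg: "(\<And>v. 0 \<le> x v) \<Longrightarrow> 0 \<le> weight K x \<sigma>"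
  unfolding weight_def by (intro mult_nonneg_nonneg prod_nonneg) auto

lemma weight_nonzeroD:
  assumes "weight K x \<sigma> \<noteq> 0" "finite (verts K)" "\<sigma> \<subseteq> verts K" "v \<in> \<sigma>" "w \<in> verts K" "w \<notin> \<sigma>"
  shows "x w < x v"
proof (rule ccontr)
  assume "\<not> x w < x v"
  then have "(\<Prod>w\<in>verts K - \<sigma>. max 0 (x v - x w)) = 0"
    using assms by (intro prod_zero) (auto intro!: bexI[of _ w])
  then have "(\<Prod>v\<in>\<sigma>. \<Prod>w\<in>verts K - \<sigma>. max 0 (x v - x w)) = 0"
    using assms finite_subset[OF assms(3,2)] by (intro prod_zero) auto
  then show False
    using assms(1) by (simp add: weight_def)
qed

text \<open>Incomparable simplices of non-zero weight would contain two vertices, each with a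
  strictly larger coordinate than the other.\<close>

lemma weight_chain:
  assumes "finite (verts K)" "\<sigma> \<subseteq> verts K" "\<tau> \<subseteq> verts K" "weight K x \<sigma> \<noteq> 0" "weight K x \<tau> \<noteq> 0"
  shows "\<sigma> \<subseteq> \<tau> \<or> \<tau> \<subseteq> \<sigma>"
proof (rule ccontr)
  assume "\<not> ?thesis"
  then obtain v w where vw: "v \<in> \<sigma>" "v \<notin> \<tau>" "w \<in> \<tau>" "w \<notin> \<sigma>"
    by blast
  have "x w < x v"
    using weight_nonzeroD[OF assms(4,1,2) vw(1) _ vw(4)] vw(3) assms(3) by blast
  moreover have "x v < x w"
    using weight_nonzeroD[OF assms(5,1,3) vw(3) _ vw(2)] vw(1) assms(2) by blast
  ultimately show False
    by simp
qed

text \<open>Coordinates are positive on the support and 0 off it, so every factor is positive. This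
  summand makes the total weight positive, so that weights can be normalized.\<close>

lemma weight_support_pos:
  assumes "x \<in> realization (simps K)" "finite (verts K)"
  shows "0 < weight K x {v. x v \<noteq> 0}"
proof -
  have "0 < x v" if "x v \<noteq> 0" for v
    using realization_nonneg[OF assms(1), of v] that by simp
  then show ?thesis
    unfolding weight_def by (intro mult_pos_pos prod_pos) auto
qed

text \<open>A group element permutes the vertices, hence carries the complement of \<sigma> to the
  complement of its image, and every factor reappears.\<close>

lemma weight_equivariant:
  assumes "group G" "G_complex G K" "g \<in> carrier G" "\<sigma> \<in> simps K"
    and x: "{v. x v \<noteq> 0} \<subseteq> verts K"
  shows "weight K (affine_ext (vact K g) x) (vact K g ` \<sigma>) = weight K x \<sigma>"
proof -
  let ?a = "vact K g"
  have V: "\<sigma> \<subseteq> verts K"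
    using assms(4) by (rule Union_upper)
  have bij: "bij_betw ?a (verts K) (verts K)"
    by (rule vact_bij[OF assms(1-3)])
  have inj: "inj_on ?a (verts K)"
    by (rule bij_betw_imp_inj_on[OF bij])
  have diff: "verts K - ?a ` \<sigma> = ?a ` (verts K - \<sigma>)"
    using inj_on_image_set_diff[OF inj, of "verts K" \<sigma>] V bij_betw_imp_surj_on[OF bij] by simp
  have ev: "affine_ext ?a x (?a v) = x v" if "v \<in> verts K" for v
    by (rule affine_ext_apply[OF inj x that])
  have inj1: "inj_on ?a \<sigma>" and inj2: "inj_on ?a (verts K - \<sigma>)"
    using inj_on_subset[OF inj V] inj_on_subset[OF inj Diff_subset] .
  have "(\<Prod>v\<in>?a ` \<sigma>. affine_ext ?a x v) = (\<Prod>v\<in>\<sigma>. x v)"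
    unfolding prod.reindex[OF inj1] o_def by (intro prod.cong refl ev subsetD[OF V])
  moreover have "(\<Prod>v\<in>?a ` \<sigma>. \<Prod>w\<in>verts K - ?a ` \<sigma>. max 0 (affine_ext ?a x v - affine_ext ?a x w))
      = (\<Prod>v\<in>\<sigma>. \<Prod>w\<in>verts K - \<sigma>. max 0 (x v - x w))"
    unfolding diff prod.reindex[OF inj1] prod.reindex[OF inj2] o_def
    by (intro prod.cong refl) (simp only: ev[OF subsetD[OF V]] ev[OF DiffD1])
  ultimately show ?thesis
    unfolding weight_def by simp
qed

lemma sum_weight_pos:
  assumes "finite (simps K)" "finite (verts K)" "x \<in> realization (simps K)"
  shows "0 < (\<Sum>\<sigma>\<in>simps K. weight K x \<sigma>)"
  by (rule sum_pos2[OF assms(1) realization_support[OF assms(3)]])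
    (rule weight_support_pos[OF assms(3,2)], rule weight_nonneg, rule realization_nonneg[OF assms(3)])

text \<open>Each simplex \<sigma> contributes its normalized weight to the vertex
  \<open>q \<sigma>\<close>. The simplices of non-zero weight form a chain, so \<open>chain\<close>
  puts the image point into a simplex of \<open>Y\<close>. The target \<open>Y\<close> will be a
  subdivision of \<open>K\<close> or a universal space.\<close>

lemma gspace_map_of_chain_map:
  fixes K :: "('g, 'v) gcomplex" and Y :: "('g, 'w) gcomplex"
  assumes G: "group G" and K: "G_complex G K" "finite (simps K)"
    and Y: "simplicial_complex (simps Y)"
    and chain: "\<And>C. C \<noteq> {} \<Longrightarrow> C \<subseteq> simps K \<Longrightarrow> chain_subset C \<Longrightarrow> q ` C \<in> simps Y"
    and equiv: "\<And>g \<sigma>. g \<in> carrier G \<Longrightarrow> \<sigma> \<in> simps K \<Longrightarrow> q (vact K g ` \<sigma>) = vact Y g (q \<sigma>)"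
  shows "\<exists>f. gspace_map G (realization_gspace K) (realization_gspace Y) f"
proof -
  have finV: "finite (verts K)"
    using K(2) G_complex_simplexD(1)[OF K(1)] by blast
  have VK: "\<sigma> \<subseteq> verts K" if "\<sigma> \<in> simps K" for \<sigma>
    using that by (rule Union_upper)
  define c where "c x \<sigma> = weight K x \<sigma> / (\<Sum>\<sigma>\<in>simps K. weight K x \<sigma>)" for x \<sigma>
  \<comment> \<open>Several simplices may share a value of \<open>q\<close>, so the weights are
    added over each fibre.\<close>
  define f where "f x w = (\<Sum>\<sigma>\<in>simps K. if q \<sigma> = w then c x \<sigma> else 0)" for x w
  have pos: "0 < (\<Sum>\<sigma>\<in>simps K. weight K x \<sigma>)" if "x \<in> realization (simps K)" for x
    by (rule sum_weight_pos[OF K(2) finV that])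
  have c_nonneg: "0 \<le> c x \<sigma>" if "x \<in> realization (simps K)" for x \<sigma>
    unfolding c_def using pos[OF that] realization_nonneg[OF that]
    by (intro divide_nonneg_pos weight_nonneg)
  have c_sum: "(\<Sum>\<sigma>\<in>simps K. c x \<sigma>) = 1" if "x \<in> realization (simps K)" for x
    unfolding c_def sum_divide_distrib[symmetric] using pos[OF that] by simp
  have f_outside: "f x w = 0" if "w \<notin> q ` {\<sigma>\<in>simps K. c x \<sigma> \<noteq> 0}" for x w
    unfolding f_def using that by (intro sum.neutral) auto
  have real: "f x \<in> realization (simps Y)" if x: "x \<in> realization (simps K)" for x
  proof (rule realizationI[OF Y])
    let ?C = "{\<sigma>\<in>simps K. c x \<sigma> \<noteq> 0}"
    show "0 \<le> f x w" for w
      unfolding f_def by (intro sum_nonneg) (simp add: c_nonneg[OF x])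
    have "?C \<noteq> {}"
    proof
      assume "?C = {}"
      then have "(\<Sum>\<sigma>\<in>simps K. c x \<sigma>) = 0"
        by (intro sum.neutral) auto
      then show False
        using c_sum[OF x] by simp
    qed
    moreover have "chain_subset ?C"
      unfolding chain_subset_def
    proof (intro ballI)
      fix \<sigma> \<tau> assume "\<sigma> \<in> ?C" "\<tau> \<in> ?C"
      then show "\<sigma> \<subseteq> \<tau> \<or> \<tau> \<subseteq> \<sigma>"
        by (intro weight_chain[OF finV VK VK, of _ _ x]) (auto simp: c_def)
    qed
    ultimately show "q ` ?C \<in> simps Y"
      by (intro chain) auto
    show "{w. f x w \<noteq> 0} \<subseteq> q ` ?C"
      using f_outside[of _ x] by blast
    have "(\<Sum>w\<in>q ` ?C. f x w) = (\<Sum>w\<in>q ` simps K. f x w)"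
      using K(2) f_outside[of _ x] by (intro sum.mono_neutral_left) auto
    also have "\<dots> = (\<Sum>\<sigma>\<in>simps K. \<Sum>w\<in>q ` simps K. if q \<sigma> = w then c x \<sigma> else 0)"
      unfolding f_def by (rule sum.swap)
    also have "\<dots> = (\<Sum>\<sigma>\<in>simps K. c x \<sigma>)"
      using K(2) by (intro sum.cong refl) (simp add: sum.delta)
    finally show "(\<Sum>w\<in>q ` ?C. f x w) = 1"
      using c_sum[OF x] by simp
  qed
  have coord: "continuous_on (realization (simps K)) (\<lambda>x. x v)" for v :: 'v
    using continuous_on_subset[OF continuous_on_product_coordinates subset_UNIV] .
  have "continuous_on (realization (simps K)) f"
  proof (rule continuous_on_coordinatewise_then_product)
    fix w
    have wc: "continuous_on (realization (simps K)) (\<lambda>x. weight K x \<sigma>)" for \<sigma>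
      unfolding weight_def by (intro continuous_intros coord)
    have cc: "continuous_on (realization (simps K)) (\<lambda>x. c x \<sigma>)" for \<sigma>
      unfolding c_def using pos
      by (intro continuous_on_divide wc continuous_on_sum ballI) (metis less_irrefl)
    have "continuous_on (realization (simps K)) (\<lambda>x. if q \<sigma> = w then c x \<sigma> else 0)" for \<sigma>
      by (cases "q \<sigma> = w") (simp_all add: cc)
    then show "continuous_on (realization (simps K)) (\<lambda>x. f x w)"
      unfolding f_def by (intro continuous_on_sum)
  qed
  moreover have "equivariant_on G (realization (simps K))
      (\<lambda>g. affine_ext (vact K g)) (\<lambda>g. affine_ext (vact Y g)) f"
    unfolding equivariant_on_def
  proof (intro ballI ext)
    fix g x w assume g: "g \<in> carrier G" and x: "x \<in> realization (simps K)"
    let ?a = "vact K g" and ?b = "vact Y g"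
    have bij: "bij_betw ((`) ?a) (simps K) (simps K)"
      by (rule simps_bij[OF G K(1) g])
    have supp: "{v. x v \<noteq> 0} \<subseteq> verts K"
      using realization_support[OF x] by (rule Union_upper)
    have w: "weight K (affine_ext ?a x) (?a ` \<sigma>) = weight K x \<sigma>" if "\<sigma> \<in> simps K" for \<sigma>
      by (rule weight_equivariant[OF G K(1) g that supp])
    \<comment> \<open>The normalizing total is invariant because \<open>g\<close> permutes the
      simplices.\<close>
    have "(\<Sum>\<sigma>\<in>simps K. weight K (affine_ext ?a x) \<sigma>) =
        (\<Sum>\<sigma>\<in>simps K. weight K (affine_ext ?a x) (?a ` \<sigma>))"
      by (rule sum.reindex_bij_betw[OF bij, symmetric])
    also have "\<dots> = (\<Sum>\<sigma>\<in>simps K. weight K x \<sigma>)"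
      by (intro sum.cong refl w)
    finally have ca: "c (affine_ext ?a x) (?a ` \<sigma>) = c x \<sigma>" if "\<sigma> \<in> simps K" for \<sigma>
      unfolding c_def using w[OF that] by simp
    have "f (affine_ext ?a x) w =
        (\<Sum>\<sigma>\<in>simps K. if q (?a ` \<sigma>) = w then c (affine_ext ?a x) (?a ` \<sigma>) else 0)"
      unfolding f_def by (rule sum.reindex_bij_betw[OF bij, symmetric])
    also have "\<dots> = (\<Sum>\<sigma>\<in>simps K. if ?b (q \<sigma>) = w then c x \<sigma> else 0)"
      by (intro sum.cong refl) (simp add: ca equiv[OF g])
    \<comment> \<open>Inserting a sum over the values \<open>u\<close> of \<open>q\<close> groups
      the simplices by fibre; after the interchange the inner sums are the coordinates of
      \<open>f x\<close>.\<close>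
    also have "\<dots> = (\<Sum>\<sigma>\<in>simps K. \<Sum>u\<in>q ` simps K.
        if q \<sigma> = u then if ?b u = w then c x \<sigma> else 0 else 0)"
      using K(2) by (intro sum.cong refl) (simp add: sum.delta)
    also have "\<dots> = (\<Sum>u\<in>q ` simps K. \<Sum>\<sigma>\<in>simps K.
        if q \<sigma> = u then if ?b u = w then c x \<sigma> else 0 else 0)"
      by (rule sum.swap)
    also have "\<dots> = (\<Sum>u\<in>q ` simps K. if ?b u = w then f x u else 0)"
      unfolding f_def by (intro sum.cong refl) (simp cong: if_cong)
    also have "\<dots> = affine_ext ?b (f x) w"
      using K(2) f_outside[of _ x] by (intro affine_ext_sum[symmetric]) auto
    finally show "f (affine_ext ?a x) w = affine_ext ?b (f x) w" .
  qed
  ultimately have "gspace_map G (realization_gspace K) (realization_gspace Y) f"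
    using real by (auto simp: gspace_map_def continuous_map_in_subtopology)
  then show ?thesis
    by (rule exI[of _ f])
qed

text \<open>The case \<open>q = e\<close>, where chains go to simplices by definition. Through this
  map, equivariant maps out of the subdivision pull back to \<open>K\<close>.\<close>

lemma (in coded_complex) gspace_map_sd:
  "\<exists>f. gspace_map G (realization_gspace K) (realization_gspace sd) f"
proof (rule gspace_map_of_chain_map[OF is_group K_complex K_finite simplicial_complex_sd])
  show "e ` C \<in> simps sd" if "C \<noteq> {}" "C \<subseteq> simps K" "chain_subset C" for C
    unfolding simps_sd using that by blast
qed (simp add: vact_sd)

section \<open>The universal spaces and the cross-posets\<close>

text \<open>The simplices of the discrete complex are singletons, so a simplex of the join chooses
  at most one group element per level.\<close>

lemma simps_E:
  "\<sigma> \<in> simps (join_power (discrete_gcomplex G) k) \<longleftrightarrow>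
     \<sigma> \<noteq> {} \<and> \<sigma> \<subseteq> carrier G \<times> {..k} \<and> (\<forall>g h i. (g, i) \<in> \<sigma> \<longrightarrow> (h, i) \<in> \<sigma> \<longrightarrow> g = h)"
  (is "?L \<longleftrightarrow> ?R")
proof
  assume L: ?L
  then have k: "i \<le> k" if "(g, i) \<in> \<sigma>" for g i
    using that by (auto simp: join_power_def)
  have sing: "\<exists>h\<in>carrier G. \<forall>v. (v, i) \<in> \<sigma> \<longleftrightarrow> v = h" if "(g, i) \<in> \<sigma>" for g i
  proof -
    have "{v. (v, i) \<in> \<sigma>} = {} \<or> {v. (v, i) \<in> \<sigma>} \<in> {{h} |h. h \<in> carrier G}"
      using L k[OF that] by (simp add: join_power_def discrete_gcomplex_def)
    then show ?thesis
      using that by (auto simp: set_eq_iff)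
  qed
  have "g \<in> carrier G" if "(g, i) \<in> \<sigma>" for g i
    using sing[OF that] that by auto
  moreover have "g = h" if "(g, i) \<in> \<sigma>" "(h, i) \<in> \<sigma>" for g h i
    using sing[OF that(1)] that by auto
  moreover have "\<sigma> \<noteq> {}"
    using L by (simp add: join_power_def)
  ultimately show ?R
    using k by (auto intro!: subrelI)
next
  assume R: ?R
  have "{v. (v, i) \<in> \<sigma>} = {} \<or> (\<exists>h. {v. (v, i) \<in> \<sigma>} = {h} \<and> h \<in> carrier G)" for i
  proof (cases "{v. (v, i) \<in> \<sigma>} = {}")
    case False
    then obtain h where h: "(h, i) \<in> \<sigma>"
      by blast
    then have "{v. (v, i) \<in> \<sigma>} = {h}" "h \<in> carrier G"
      using R by blast+
    then show ?thesis
      by blast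
  qed simp
  then show ?L
    using R by (auto simp: join_power_def discrete_gcomplex_def)
qed

lemma vact_E [simp]:
  "vact (join_power (discrete_gcomplex G) k) g = (\<lambda>(h, i). (g \<otimes>\<^bsub>G\<^esub> h, i))"
  by (simp add: join_power_def discrete_gcomplex_def)

lemma simplicial_complex_E:
  assumes "finite (carrier G)"
  shows "simplicial_complex (simps (join_power (discrete_gcomplex G) k))"
  unfolding simplicial_complex_def
proof (intro conjI ballI allI impI)
  fix \<sigma> assume "\<sigma> \<in> simps (join_power (discrete_gcomplex G) k)"
  then have \<sigma>: "\<sigma> \<noteq> {}" "\<sigma> \<subseteq> carrier G \<times> {..k}" "\<forall>g h i. (g, i) \<in> \<sigma> \<longrightarrow> (h, i) \<in> \<sigma> \<longrightarrow> g = h"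
    unfolding simps_E by blast+
  show "finite \<sigma>" "\<sigma> \<noteq> {}"
    using \<sigma>(1) finite_subset[OF \<sigma>(2)] assms by simp_all
  fix \<tau> assume \<tau>: "\<tau> \<noteq> {} \<and> \<tau> \<subseteq> \<sigma>"
  have "\<tau> \<subseteq> carrier G \<times> {..k}"
    using \<tau> \<sigma>(2) by (blast intro: subset_trans)
  moreover have "\<forall>g h i. (g, i) \<in> \<tau> \<longrightarrow> (h, i) \<in> \<tau> \<longrightarrow> g = h"
    using \<tau> \<sigma>(3) by (meson subsetD)
  ultimately show "\<tau> \<in> simps (join_power (discrete_gcomplex G) k)"
    unfolding simps_E using \<tau> by (intro conjI) simp_all
qed

lemma E_point_carrier:
  assumes "y \<in> realization (simps (join_power (discrete_gcomplex G) k))" "y (h, i) \<noteq> 0"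
  shows "h \<in> carrier G" "i \<le> k"
  using realization_support[OF assms(1)] assms(2) unfolding simps_E by auto

lemma E_point_unique:
  assumes "y \<in> realization (simps (join_power (discrete_gcomplex G) k))"
    "y (h, i) \<noteq> 0" "y (h', i) \<noteq> 0"
  shows "h = h'"
  using realization_support[OF assms(1)] assms(2,3) unfolding simps_E by auto

text \<open>Pigeonhole: the support has at most one vertex on each of the \<open>k + 1\<close>
  levels, and the coordinates sum to 1.\<close>

lemma E_point_large_coordinate:
  assumes y: "y \<in> realization (simps (join_power (discrete_gcomplex G) k))"
  shows "\<exists>h i. 1 / (real k + 1) \<le> y (h, i)"
proof (rule ccontr)
  assume "\<not> ?thesis"
  then have less: "y u < 1 / (real k + 1)" for u
    by (cases u) (auto simp: not_le)
  let ?S = "{u. y u \<noteq> 0}"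
  have supp: "?S \<in> simps (join_power (discrete_gcomplex G) k)"
    by (rule realization_support[OF y])
  then have S: "?S \<noteq> {}" "snd ` ?S \<subseteq> {..k}"
    unfolding simps_E by auto
  have inj: "inj_on snd ?S"
    using E_point_unique[OF y] by (auto simp: inj_on_def)
  have fin: "finite ?S"
    using inj finite_subset[OF S(2)] by (auto dest: finite_imageD)
  have "card ?S \<le> k + 1"
    using card_inj_on_le[OF inj S(2)] by simp
  have "1 = (\<Sum>u\<in>?S. y u)"
    using y by (simp add: realization_def)
  also have "\<dots> < (\<Sum>u\<in>?S. 1 / (real k + 1))"
    by (rule sum_strict_mono[OF fin S(1) less])
  also have "\<dots> = real (card ?S) / (real k + 1)"
    by simp
  also have "\<dots> \<le> 1"
    using \<open>card ?S \<le> k + 1\<close> by simp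
  finally show False
    by simp
qed

lemma E_action_apply:
  assumes "group G" "y \<in> realization (simps (join_power (discrete_gcomplex G) k))"
    and "g \<in> carrier G" "h \<in> carrier G"
  shows "affine_ext (\<lambda>(h, i). (g \<otimes>\<^bsub>G\<^esub> h, i)) y (g \<otimes>\<^bsub>G\<^esub> h, i) = y (h, i)"
proof -
  interpret group G by fact
  let ?a = "\<lambda>(h, i). (g \<otimes>\<^bsub>G\<^esub> h, i)"
  \<comment> \<open>The level \<open>i\<close> is arbitrary and may exceed \<open>k\<close>, so the
    bound has to cover both \<open>i\<close> and the support.\<close>
  have "inj_on ?a (carrier G \<times> {..max i k})"
    using assms(3) by (auto simp: inj_on_def)
  moreover have "{u. y u \<noteq> 0} \<subseteq> carrier G \<times> {..max i k}"
    using E_point_carrier[OF assms(2)] by (auto simp: le_max_iff_disj)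
  ultimately show ?thesis
    using affine_ext_apply[of ?a _ y "(h, i)"] assms(4) by simp
qed

section \<open>Passing between cross-maps and equivariant maps\<close>

text \<open>Distinct comparable elements of the cross-poset lie on different levels, so the image of
  a chain has at most one element per level, which is a simplex of the universal space.\<close>

lemma gspace_map_of_cross_map:
  fixes K :: "('g, 'v) gcomplex"
  assumes "group G" "finite (carrier G)" "G_complex G K" "finite (simps K)"
    and p: "gposet_map G (face_gposet K) (Q_gposet G n) p"
  shows "\<exists>f. gspace_map G (realization_gspace K) (E_gspace G n) f"
  unfolding E_gspace_def
proof (rule gspace_map_of_chain_map[OF assms(1,3,4) simplicial_complex_E[OF assms(2)]])
  have mem: "p \<sigma> \<in> carrier G \<times> {..n}" if "\<sigma> \<in> simps K" for \<sigma>
    using p that by (auto simp: gposet_map_def face_gposet_def Q_gposet_def Pi_iff)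
  have mono: "p \<sigma> = p \<tau> \<or> snd (p \<sigma>) < snd (p \<tau>)"
    if "\<sigma> \<in> simps K" "\<tau> \<in> simps K" "\<sigma> \<subseteq> \<tau>" for \<sigma> \<tau>
    using p that
    by (auto simp: gposet_map_def face_gposet_def Q_gposet_def monotone_on_def split_beta prod_eq_iff)
  show "p ` C \<in> simps (join_power (discrete_gcomplex G) n)"
    if C: "C \<noteq> {}" "C \<subseteq> simps K" "chain_subset C" for C
    unfolding simps_E
  proof (intro conjI allI impI)
    show "p ` C \<noteq> {}"
      using C(1) by simp
    show "p ` C \<subseteq> carrier G \<times> {..n}"
      using C(2) mem by blast
    fix g h i assume "(g, i) \<in> p ` C" "(h, i) \<in> p ` C"
    then obtain \<sigma> \<tau> where st: "\<sigma> \<in> C" "p \<sigma> = (g, i)" "\<tau> \<in> C" "p \<tau> = (h, i)"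
      by (metis imageE)
    then have "\<sigma> \<subseteq> \<tau> \<or> \<tau> \<subseteq> \<sigma>"
      using C(3) unfolding chain_subset_def by blast
    then show "g = h"
      using mono[of \<sigma> \<tau>] mono[of \<tau> \<sigma>] st C(2) by (auto simp: subset_iff)
  qed
  show "p (vact K g ` \<sigma>) = vact (join_power (discrete_gcomplex G) n) g (p \<sigma>)"
    if "g \<in> carrier G" "\<sigma> \<in> simps K" for g \<sigma>
    using p that by (auto simp: gposet_map_def equivariant_on_def face_gposet_def Q_gposet_def)
qed

text \<open>
  At every point of \<open>E\<^sub>k G\<close> some coordinate is at least \<open>1 / (k + 1)\<close>. The group element at which
  this happens on a given level is unique throughout a cell: another element would force the
  coordinate to drop to \<open>0\<close> within the cell.
\<close>

lemma cross_map_of_small_oscillation: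
  fixes X :: "('g, 'a) gspace" and P :: "('g, 'p) gposet" and cell :: "'p \<Rightarrow> 'a set"
  assumes "group G" and f: "gspace_map G X (E_gspace G k) f"
    and cell: "\<And>p. p \<in> elems P \<Longrightarrow> cell p \<subseteq> topspace (space_top X)"
      "\<And>p. p \<in> elems P \<Longrightarrow> cell p \<noteq> {}"
      "\<And>p q. p \<in> elems P \<Longrightarrow> q \<in> elems P \<Longrightarrow> le P p q \<Longrightarrow> cell p \<subseteq> cell q"
    and act: "\<And>g p. g \<in> carrier G \<Longrightarrow> p \<in> elems P \<Longrightarrow> pact P g p \<in> elems P"
      "\<And>g p. g \<in> carrier G \<Longrightarrow> p \<in> elems P \<Longrightarrow> cell (pact P g p) = sact X g ` cell p"
    and osc: "\<And>p x y u. p \<in> elems P \<Longrightarrow> x \<in> cell p \<Longrightarrow> y \<in> cell p \<Longrightarrow>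
                \<bar>f x u - f y u\<bar> < 1 / (real k + 1)"
  shows "\<exists>\<phi>. gposet_map G P (Q_gposet G k) \<phi>"
proof -
  interpret group G by fact
  let ?c = "1 / (real k + 1)"
  define R where "R p h i \<longleftrightarrow> (\<exists>x\<in>cell p. ?c \<le> f x (h, i))" for p h i
  have c: "0 < ?c"
    by simp
  have fE: "f x \<in> realization (simps (join_power (discrete_gcomplex G) k))"
    if "p \<in> elems P" "x \<in> cell p" for x p
  proof -
    have "x \<in> topspace (space_top X)"
      using cell(1)[OF that(1)] that(2) by (rule subsetD)
    then show ?thesis
      using f unfolding gspace_map_def E_gspace_def by (auto simp: continuous_map_in_subtopology)
  qed
  have fact: "f (sact X g x) = affine_ext (\<lambda>(h, i). (g \<otimes>\<^bsub>G\<^esub> h, i)) (f x)"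
    if "g \<in> carrier G" "p \<in> elems P" "x \<in> cell p" for g x p
  proof -
    have "x \<in> topspace (space_top X)"
      using cell(1)[OF that(2)] that(3) by (rule subsetD)
    then show ?thesis
      using f that(1) unfolding gspace_map_def E_gspace_def equivariant_on_def by simp
  qed
  have R_carrier: "h \<in> carrier G" "i \<le> k" if R: "R p h i" and p: "p \<in> elems P" for p h i
  proof -
    obtain x where x: "x \<in> cell p" "?c \<le> f x (h, i)"
      using R unfolding R_def by blast
    then have "f x (h, i) \<noteq> 0"
      using c by linarith
    then show "h \<in> carrier G" "i \<le> k"
      using E_point_carrier[OF fE[OF p x(1)]] by blast+
  qed
  have R_unique: "h = h'" if p: "p \<in> elems P" and R: "R p h i" "R p h' i" for p h h' i
  proof (rule ccontr)
    assume neq: "h \<noteq> h'"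
    obtain x y where x: "x \<in> cell p" "?c \<le> f x (h, i)" and y: "y \<in> cell p" "?c \<le> f y (h', i)"
      using R unfolding R_def by blast
    have "f y (h', i) \<noteq> 0"
      using y(2) c by linarith
    then have "f y (h, i) = 0"
      using neq E_point_unique[OF fE[OF p y(1)]] by metis
    then show False
      using osc[OF p x(1) y(1), of "(h, i)"] x(2) by simp
  qed
  have R_ex: "\<exists>i h. R p h i" if p: "p \<in> elems P" for p
  proof -
    obtain x where "x \<in> cell p"
      using cell(2)[OF p] by blast
    then show ?thesis
      using E_point_large_coordinate[OF fE[OF p]] unfolding R_def by blast
  qed
  have R_act: "R (pact P g p) (g \<otimes>\<^bsub>G\<^esub> h) i"
    if g: "g \<in> carrier G" and p: "p \<in> elems P" and R: "R p h i" for g p h i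
  proof -
    obtain x where x: "x \<in> cell p" "?c \<le> f x (h, i)"
      using R unfolding R_def by blast
    have "f (sact X g x) (g \<otimes>\<^bsub>G\<^esub> h, i) = f x (h, i)"
      unfolding fact[OF g p x(1)]
      by (rule E_action_apply[OF is_group fE[OF p x(1)] g R_carrier(1)[OF R p]])
    then show ?thesis
      unfolding R_def act(2)[OF g p] using x by (intro bexI[OF _ imageI[OF x(1)]]) simp
  qed
  \<comment> \<open>Together with \<open>R_act\<close> this shows that a cell and its translate
    attain the same levels, so that \<open>idx\<close> is invariant.\<close>
  have R_act': "\<exists>h. R p h i" if g: "g \<in> carrier G" and p: "p \<in> elems P" and R: "R (pact P g p) h' i"
    for g p h' i
  proof -
    obtain x where x: "x \<in> cell p" "?c \<le> f (sact X g x) (h', i)"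
      using R unfolding R_def act(2)[OF g p] by blast
    then have "affine_ext (\<lambda>(h, i). (g \<otimes>\<^bsub>G\<^esub> h, i)) (f x) (h', i) \<noteq> 0"
      unfolding fact[OF g p x(1)] using c by linarith
    then have "(h', i) \<in> (\<lambda>(h, i). (g \<otimes>\<^bsub>G\<^esub> h, i)) ` {u. f x u \<noteq> 0}"
      by (rule contrapos_np) (rule affine_ext_outside)
    then obtain h where h: "f x (h, i) \<noteq> 0" "h' = g \<otimes>\<^bsub>G\<^esub> h"
      by auto
    have "?c \<le> f x (h, i)"
      using x(2) E_action_apply[OF is_group fE[OF p x(1)] g E_point_carrier(1)[OF fE[OF p x(1)] h(1)]]
      unfolding h(2) fact[OF g p x(1)] by simp
    then show ?thesis
      unfolding R_def using x(1) by blast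
  qed
  define idx where "idx p = Max {i. \<exists>h. R p h i}" for p
  define elt where "elt p = (SOME h. R p h (idx p))" for p
  have fin: "finite {i. \<exists>h. R p h i}" if "p \<in> elems P" for p
    by (rule finite_subset[of _ "{..k}"]) (use R_carrier(2)[OF _ that] in auto)
  have R_idx: "R p (elt p) (idx p)" if "p \<in> elems P" for p
  proof -
    have "idx p \<in> {i. \<exists>h. R p h i}"
      unfolding idx_def using fin[OF that] R_ex[OF that] by (intro Max_in) auto
    then show ?thesis
      unfolding elt_def by (auto intro: someI)
  qed
  have idx_max: "i \<le> idx p" if "p \<in> elems P" "R p h i" for p h i
    unfolding idx_def by (rule Max_ge[OF fin[OF that(1)]]) (use that(2) in blast)
  have "gposet_map G P (Q_gposet G k) (\<lambda>p. (elt p, idx p))"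
    unfolding gposet_map_def
  proof (intro conjI)
    show "(\<lambda>p. (elt p, idx p)) \<in> elems P \<rightarrow> elems (Q_gposet G k)"
      using R_carrier[OF R_idx] by (simp add: Q_gposet_def)
    show "monotone_on (elems P) (le P) (le (Q_gposet G k)) (\<lambda>p. (elt p, idx p))"
    proof (rule monotone_onI)
      fix p q assume pq: "p \<in> elems P" "q \<in> elems P" "le P p q"
      \<comment> \<open>A larger cell attains every level attained on the smaller one, so
        \<open>idx\<close> can only grow; on equal levels \<open>R_unique\<close> in the larger cell
        identifies the group elements.\<close>
      have R: "R q (elt p) (idx p)"
        using R_idx[OF pq(1)] cell(3)[OF pq] unfolding R_def by blast
      have "elt p = elt q" if "idx p = idx q"
        using R_unique[OF pq(2) R] R_idx[OF pq(2)] that by simp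
      then show "le (Q_gposet G k) (elt p, idx p) (elt q, idx q)"
        using idx_max[OF pq(2) R] by (auto simp: Q_gposet_def)
    qed
    show "equivariant_on G (elems P) (pact P) (pact (Q_gposet G k)) (\<lambda>p. (elt p, idx p))"
      unfolding equivariant_on_def
    proof (intro ballI)
      fix g p assume g: "g \<in> carrier G" and p: "p \<in> elems P"
      have "{i. \<exists>h. R (pact P g p) h i} = {i. \<exists>h. R p h i}"
        using R_act[OF g p] R_act'[OF g p] by blast
      then have idx: "idx (pact P g p) = idx p"
        by (simp add: idx_def)
      have "elt (pact P g p) = g \<otimes>\<^bsub>G\<^esub> elt p"
        by (rule R_unique[OF act(1)[OF g p] R_idx[OF act(1)[OF g p]]])
          (unfold idx, rule R_act[OF g p R_idx[OF p]])
      then show "(elt (pact P g p), idx (pact P g p)) = pact (Q_gposet G k) g (elt p, idx p)"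
        using idx by (simp add: Q_gposet_def)
    qed
  qed
  then show ?thesis
    by blast
qed

text \<open>
  Uniform continuity on a compact space whose topology is only known to admit a continuous
  \<open>d\<close> that separates points; spaces of functions on an arbitrary vertex type carry no metric.
\<close>

lemma uniform_oscillation:
  fixes S :: "'a::topological_space set" and f :: "'a \<Rightarrow> 'b \<Rightarrow> real"
  assumes S: "compact S" and f: "continuous_on S f" and d: "continuous_on (S \<times> S) d"
    and pos: "\<And>x y. x \<in> S \<Longrightarrow> y \<in> S \<Longrightarrow> x \<noteq> y \<Longrightarrow> 0 < d (x, y)"
    and U: "finite U" and \<epsilon>: "(0::real) < \<epsilon>"
  shows "\<exists>\<delta>::real>0. \<forall>x\<in>S. \<forall>y\<in>S. d (x, y) < \<delta> \<longrightarrow> (\<forall>u\<in>U. \<bar>f x u - f y u\<bar> < \<epsilon>)"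
proof -
  define F where "F p = (\<Sum>u\<in>U. \<bar>f (fst p) u - f (snd p) u\<bar>)" for p
  have fu: "continuous_on S (\<lambda>x. f x u)" for u
    using f by (rule continuous_on_product_then_coordinatewise)
  have fst: "continuous_on (S \<times> S) (\<lambda>p. f (fst p) u)" and snd: "continuous_on (S \<times> S) (\<lambda>p. f (snd p) u)" for u
    by (rule continuous_on_compose2[OF fu]; force intro!: continuous_intros)+
  have F: "continuous_on (S \<times> S) F"
    unfolding F_def by (intro continuous_intros fst snd)
  have FU: "\<bar>f x u - f y u\<bar> \<le> F (x, y)" if "u \<in> U" for x y u
    unfolding F_def using member_le_sum[OF that, of "\<lambda>u. \<bar>f x u - f y u\<bar>"] U by simp
  \<comment> \<open>The pairs of points with large total oscillation form a compact set that avoids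
    the diagonal. The minimum of \<open>d\<close> on it is the required \<delta>; if the set is
    empty, any positive number will do.\<close>
  let ?A = "S \<times> S \<inter> F -` {\<epsilon>..}"
  have "closedin (top_of_set (S \<times> S)) ?A"
    by (rule continuous_closedin_preimage[OF F closed_atLeast])
  then have A: "compact ?A"
    by (rule closedin_compact[OF compact_Times[OF S S]])
  show ?thesis
  proof (cases "?A = {}")
    case True
    have "\<bar>f x u - f y u\<bar> < \<epsilon>" if "x \<in> S" "y \<in> S" "u \<in> U" for x y u
    proof -
      have "(x, y) \<notin> ?A"
        using True by simp
      then show ?thesis
        using that FU[OF that(3), of x y] by auto
    qed
    then show ?thesis
      by (intro exI[of _ 1]) auto
  next
    case False
    then obtain a where a: "a \<in> ?A" "\<And>p. p \<in> ?A \<Longrightarrow> d a \<le> d p"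
      using continuous_attains_inf[OF A False continuous_on_subset[OF d Int_lower1]] by blast
    have "fst a \<noteq> snd a"
      using a(1) \<epsilon> by (auto simp: F_def)
    then have "0 < d a"
      using pos[of "fst a" "snd a"] a(1) by auto
    moreover have "\<bar>f x u - f y u\<bar> < \<epsilon>" if "x \<in> S" "y \<in> S" "d (x, y) < d a" "u \<in> U" for x y u
    proof -
      have "(x, y) \<notin> ?A"
        using a(2)[of "(x, y)"] that(3) by auto
      then show ?thesis
        using that FU[OF that(4), of x y] by auto
    qed
    ultimately show ?thesis
      by (intro exI[of _ "d a"]) auto
  qed
qed

text \<open>Coordinates outside the finite set \<open>carrier G \<times> {..k}\<close> vanish on the
  universal space, so a bound for finitely many coordinates covers all of them.\<close>

lemma uniform_oscillation_E:
  fixes X :: "('g, 'a::topological_space) gspace"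
  assumes "finite (carrier G)" and X: "space_top X = top_of_set S" and S: "compact S"
    and f: "gspace_map G X (E_gspace G k) f" and d: "continuous_on (S \<times> S) d"
    and pos: "\<And>x y. x \<in> S \<Longrightarrow> y \<in> S \<Longrightarrow> x \<noteq> y \<Longrightarrow> 0 < d (x, y)"
  shows "\<exists>\<delta>::real>0. \<forall>x\<in>S. \<forall>y\<in>S. d (x, y) < \<delta> \<longrightarrow> (\<forall>u. \<bar>f x u - f y u\<bar> < 1 / (real k + 1))"
proof -
  have fS: "continuous_on S f"
    and fE: "\<And>x. x \<in> S \<Longrightarrow> f x \<in> realization (simps (join_power (discrete_gcomplex G) k))"
    using f unfolding gspace_map_def E_gspace_def by (auto simp: X continuous_map_in_subtopology)
  have "finite (carrier G \<times> {..k})"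
    using assms(1) by simp
  from uniform_oscillation[OF S fS d pos this, of "1 / (real k + 1)"]
  obtain \<delta> where \<delta>: "0 < \<delta>" "\<And>x y u. x \<in> S \<Longrightarrow> y \<in> S \<Longrightarrow> d (x, y) < \<delta> \<Longrightarrow>
      u \<in> carrier G \<times> {..k} \<Longrightarrow> \<bar>f x u - f y u\<bar> < 1 / (real k + 1)"
    by auto
  have zero: "f x u = 0" if "x \<in> S" "u \<notin> carrier G \<times> {..k}" for x u
    using E_point_carrier[OF fE[OF that(1)], of "fst u" "snd u"] that(2) by (auto simp: mem_Times_iff)
  have "\<bar>f x u - f y u\<bar> < 1 / (real k + 1)" if "x \<in> S" "y \<in> S" "d (x, y) < \<delta>" for x y u
    using \<delta>(2)[OF that, of u] zero[OF that(1), of u] zero[OF that(2), of u]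
    by (cases "u \<in> carrier G \<times> {..k}") auto
  then show ?thesis
    using \<delta>(1) by blast
qed

section \<open>Fine subdivisions\<close>

text \<open>
  Placing the vertices of a simplex in a common face keeps the averages of their positions inside
  the realization.
\<close>

definition placement ::
    "('g, 'm) monoid_scheme \<Rightarrow> ('g, 'u) gcomplex \<Rightarrow> ('g, 'v) gcomplex \<Rightarrow> ('v \<Rightarrow> 'u \<Rightarrow> real) \<Rightarrow> bool" where
  "placement G M K pos \<longleftrightarrow>
     (\<forall>\<sigma>\<in>simps K. \<exists>\<tau>\<in>simps M. \<forall>v\<in>\<sigma>. pos v \<in> realization (simps M) \<and> {u. pos v u \<noteq> 0} \<subseteq> \<tau>) \<and>
     equivariant_on G (verts K) (vact K) (\<lambda>g. affine_ext (vact M g)) pos"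

text \<open>The diameter of the placed vertex sets is measured in the sup norm, coordinate by
  coordinate.\<close>

definition mesh_le :: "('g, 'v) gcomplex \<Rightarrow> ('v \<Rightarrow> 'u \<Rightarrow> real) \<Rightarrow> real \<Rightarrow> bool" where
  "mesh_le K pos D \<longleftrightarrow> (\<forall>\<sigma>\<in>simps K. \<forall>v\<in>\<sigma>. \<forall>w\<in>\<sigma>. \<forall>u. \<bar>pos v u - pos w u\<bar> \<le> D)"

text \<open>The barycentre of the placed vertices of \<sigma>, which becomes the position of the new
  vertex coding \<sigma>.\<close>

definition average :: "('v \<Rightarrow> 'u \<Rightarrow> real) \<Rightarrow> 'v set \<Rightarrow> 'u \<Rightarrow> real" where
  "average pos \<sigma> u = (\<Sum>v\<in>\<sigma>. pos v u) / real (card \<sigma>)"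

lemma placementD:
  assumes "placement G M K pos"
  shows "\<sigma> \<in> simps K \<Longrightarrow>
      \<exists>\<tau>\<in>simps M. \<forall>v\<in>\<sigma>. pos v \<in> realization (simps M) \<and> {u. pos v u \<noteq> 0} \<subseteq> \<tau>"
    and "g \<in> carrier G \<Longrightarrow> v \<in> verts K \<Longrightarrow> pos (vact K g v) = affine_ext (vact M g) (pos v)"
  using assms unfolding placement_def equivariant_on_def by blast+

lemma placement_in_realization:
  assumes "placement G M K pos" "v \<in> verts K"
  shows "pos v \<in> realization (simps M)"
  using placementD(1)[OF assms(1)] assms(2) by blast

text \<open>The start of the iteration: every vertex is placed at itself, as a unit vector.\<close>

lemma placement_unit:
  assumes "group G" "G_complex G K"
  shows "placement G K K (\<lambda>v u. if u = v then 1 else 0)"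
  unfolding placement_def equivariant_on_def
proof (intro conjI ballI)
  fix \<sigma> assume \<sigma>: "\<sigma> \<in> simps K"
  have "(\<lambda>u. if u = v then 1 else 0) \<in> realization (simps K)" if "v \<in> \<sigma>" for v
    by (rule realizationI[OF G_complex_simplicial[OF assms(2)] _ \<sigma>])
      (use that G_complex_simplexD(1)[OF assms(2) \<sigma>] in auto)
  then show "\<exists>\<tau>\<in>simps K. \<forall>v\<in>\<sigma>. (\<lambda>u. if u = v then 1 else 0) \<in> realization (simps K) \<and>
      {u. (if u = v then 1 else 0) \<noteq> (0::real)} \<subseteq> \<tau>"
    using \<sigma> by (intro bexI[OF _ \<sigma>]) simp
next
  fix g v assume g: "g \<in> carrier G" and v: "v \<in> verts K"
  have inj: "inj_on (vact K g) (verts K)"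
    by (rule vact_inj[OF assms g subset_refl])
  show "(\<lambda>u. if u = vact K g v then 1 else 0) =
      affine_ext (vact K g) (\<lambda>u. if u = v then 1 else 0 :: real)"
    by (rule affine_ext_eqI[OF vact_bij[OF assms g], symmetric])
      (use v inj vact_closed[OF assms(2) g v] in \<open>auto dest: inj_onD\<close>)
qed

text \<open>The differences \<open>p w - m\<close> are nonnegative, so their average is at least the
  single term at \<open>v\<close> divided by \<open>N\<close>.\<close>

lemma average_lower_bound:
  assumes "finite \<sigma>" "card \<sigma> \<le> N" "v \<in> \<sigma>" "\<And>w. w \<in> \<sigma> \<Longrightarrow> m \<le> p w"
  shows "m + (p v - m) / real N \<le> (\<Sum>w\<in>\<sigma>. p w) / real (card \<sigma>)"
proof -
  have c: "0 < card \<sigma>"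
    using assms(1,3) by (auto simp: card_gt_0_iff)
  have "(p v - m) / real N \<le> (p v - m) / real (card \<sigma>)"
    using assms c by (intro divide_left_mono) auto
  also have "\<dots> \<le> (\<Sum>w\<in>\<sigma>. p w - m) / real (card \<sigma>)"
    using assms by (intro divide_right_mono member_le_sum) auto
  also have "\<dots> = (\<Sum>w\<in>\<sigma>. p w) / real (card \<sigma>) - m"
    using c by (simp add: sum_subtractf diff_divide_distrib)
  finally show ?thesis
    by simp
qed

text \<open>
  Both averages contain \<open>p v\<close> with coefficient at least \<open>1 / N\<close>, so that they lie in a common
  interval of length \<open>(1 - 1 / N) D\<close>.
\<close>

lemma average_contraction:
  assumes "finite \<tau>" "card \<tau> \<le> N" "\<sigma> \<subseteq> \<tau>" "v \<in> \<sigma>"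
    and D: "\<And>w w'. w \<in> \<tau> \<Longrightarrow> w' \<in> \<tau> \<Longrightarrow> \<bar>p w - p w'\<bar> \<le> D"
  shows "\<bar>(\<Sum>w\<in>\<sigma>. p w) / real (card \<sigma>) - (\<Sum>w\<in>\<tau>. p w) / real (card \<tau>)\<bar> \<le> (1 - 1 / real N) * D"
proof -
  define m M where "m = Min (p ` \<tau>)" and "M = Max (p ` \<tau>)"
  have \<tau>: "finite (p ` \<tau>)" "p ` \<tau> \<noteq> {}" "finite \<sigma>" "v \<in> \<tau>"
    using assms finite_subset by auto
  have "card \<sigma> \<le> N"
    using card_mono[OF assms(1,3)] assms(2) by simp
  have bounds: "m \<le> p w" "p w \<le> M" if "w \<in> \<tau>" for w
    using that \<tau>(1) unfolding m_def M_def by auto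
  have "m \<in> p ` \<tau>" "M \<in> p ` \<tau>"
    unfolding m_def M_def by (rule Min_in[OF \<tau>(1,2)], rule Max_in[OF \<tau>(1,2)])
  then have MD: "M - m \<le> D"
    using D by fastforce
  have in_range: "m + (p v - m) / real N \<le> (\<Sum>w\<in>s. p w) / real (card s)"
      "(\<Sum>w\<in>s. p w) / real (card s) \<le> M - (M - p v) / real N"
    if s: "s \<subseteq> \<tau>" "v \<in> s" for s
  proof -
    have fin: "finite s" "card s \<le> N"
      using finite_subset[OF s(1) assms(1)] card_mono[OF assms(1) s(1)] assms(2) by auto
    show "m + (p v - m) / real N \<le> (\<Sum>w\<in>s. p w) / real (card s)"
      using bounds s(1) by (intro average_lower_bound[OF fin s(2)]) blast
    \<comment> \<open>The upper bound is the lower bound applied to \<open>- p\<close>, whose values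
      are at least \<open>- M\<close>.\<close>
    have "- M + (- p v - - M) / real N \<le> (\<Sum>w\<in>s. - p w) / real (card s)"
      using bounds s(1) by (intro average_lower_bound[OF fin s(2)]) auto
    then show "(\<Sum>w\<in>s. p w) / real (card s) \<le> M - (M - p v) / real N"
      by (simp add: sum_negf diff_divide_distrib)
  qed
  have "0 < N"
    using assms(1,2) \<tau>(4) by (metis card_gt_0_iff empty_iff le_zero_eq not_gr_zero)
  then have "M - (M - p v) / real N - (m + (p v - m) / real N) = (1 - 1 / real N) * (M - m)"
    by (simp add: field_simps)
  also have "\<dots> \<le> (1 - 1 / real N) * D"
    using MD \<open>0 < N\<close> by (intro mult_left_mono) auto
  finally show ?thesis
    using in_range[OF assms(3,4)] in_range[OF subset_refl \<tau>(4)] by linarith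
qed

context coded_complex
begin

text \<open>The vertices of the largest simplex of a chain are placed in a common face, which is
  convex and so contains the averages over all members. Averaging commutes with the action because
  \<open>affine_ext\<close> is linear in the coordinates.\<close>

lemma placement_sd:
  assumes M: "G_complex G M" "finite (simps M)" and pos: "placement G M K pos"
  shows "placement G M sd (average pos \<circ> inv_into (simps K) e)"
  unfolding placement_def equivariant_on_def
proof (intro conjI ballI)
  fix s assume "s \<in> simps sd"
  then obtain C where C: "s = e ` C" "C \<noteq> {}" "C \<subseteq> simps K" "chain_subset C"
    unfolding simps_sd by blast
  obtain \<sigma> where \<sigma>: "\<sigma> \<in> C" "\<And>\<rho>. \<rho> \<in> C \<Longrightarrow> \<rho> \<subseteq> \<sigma>"
    using chain_subset_top[OF C(4) finite_subset[OF C(3) K_finite] C(2)] by blast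
  have \<sigma>K: "\<sigma> \<in> simps K"
    using \<sigma>(1) C(3) by blast
  obtain \<tau> where \<tau>: "\<tau> \<in> simps M"
    "\<And>v. v \<in> \<sigma> \<Longrightarrow> pos v \<in> realization (simps M)" "\<And>v. v \<in> \<sigma> \<Longrightarrow> {u. pos v u \<noteq> 0} \<subseteq> \<tau>"
    using placementD(1)[OF pos \<sigma>K] by blast
  have fin\<tau>: "finite \<tau>"
    by (rule G_complex_simplexD(1)[OF M(1) \<tau>(1)])
  have "average pos \<rho> \<in> realization (simps M) \<and> {u. average pos \<rho> u \<noteq> 0} \<subseteq> \<tau>" if \<rho>: "\<rho> \<in> C" for \<rho>
  proof -
    have \<rho>K: "\<rho> \<in> simps K" and sub: "\<rho> \<subseteq> \<sigma>"
      using \<rho> C(3) \<sigma>(2) by blast+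
    have c: "0 < card \<rho>"
      using G_complex_simplexD(1,2)[OF K_complex \<rho>K] by (simp add: card_gt_0_iff)
    have supp: "{u. average pos \<rho> u \<noteq> 0} \<subseteq> \<tau>"
    proof
      fix u assume "u \<in> {u. average pos \<rho> u \<noteq> 0}"
      then have "(\<Sum>v\<in>\<rho>. pos v u) \<noteq> 0"
        by (auto simp: average_def)
      then obtain v where "v \<in> \<rho>" "pos v u \<noteq> 0"
        by (meson sum.neutral)
      then show "u \<in> \<tau>"
        using \<tau>(3) sub by blast
    qed
    have "(\<Sum>u\<in>\<tau>. average pos \<rho> u) = (\<Sum>v\<in>\<rho>. \<Sum>u\<in>\<tau>. pos v u) / real (card \<rho>)"
      unfolding average_def sum_divide_distrib[symmetric] by (subst sum.swap) (rule refl)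
    also have "(\<Sum>v\<in>\<rho>. \<Sum>u\<in>\<tau>. pos v u) = (\<Sum>v\<in>\<rho>. 1)"
      using sub by (intro sum.cong refl realization_sum[OF \<tau>(2) \<tau>(3) fin\<tau>]) auto
    finally have sum: "(\<Sum>u\<in>\<tau>. average pos \<rho> u) = 1"
      using c by simp
    have "0 \<le> average pos \<rho> u" for u
      unfolding average_def using sub \<tau>(2)
      by (intro divide_nonneg_nonneg sum_nonneg) (auto intro: realization_nonneg)
    then show ?thesis
      using realizationI[OF G_complex_simplicial[OF M(1)] _ \<tau>(1) supp sum] supp by blast
  qed
  then show "\<exists>\<tau>\<in>simps M. \<forall>v\<in>s. (average pos \<circ> inv_into (simps K) e) v \<in> realization (simps M) \<and>
      {u. (average pos \<circ> inv_into (simps K) e) v u \<noteq> 0} \<subseteq> \<tau>"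
    unfolding C(1) using C(3) \<tau>(1) by (intro bexI[of _ \<tau>]) (auto simp: decode subset_iff)
next
  fix g m assume g: "g \<in> carrier G" and "m \<in> verts sd"
  then obtain \<sigma> where \<sigma>: "\<sigma> \<in> simps K" "m = e \<sigma>"
    unfolding verts_sd by blast
  let ?a = "vact M g"
  have V: "\<sigma> \<subseteq> verts K"
    using \<sigma>(1) by (rule Union_upper)
  have finM: "finite (verts M)"
    using M(2) G_complex_simplexD(1)[OF M(1)] by blast
  have supp: "{u. pos v u \<noteq> 0} \<subseteq> verts M" if "v \<in> \<sigma>" for v
    using placementD(1)[OF pos \<sigma>(1)] that by blast
  have inj: "inj_on (vact K g) \<sigma>"
    by (rule vact_inj[OF is_group K_complex g V])
  have "average pos (vact K g ` \<sigma>) w = affine_ext ?a (average pos \<sigma>) w" for w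
  proof -
    have "(\<Sum>v\<in>vact K g ` \<sigma>. pos v w) = (\<Sum>v\<in>\<sigma>. affine_ext ?a (pos v) w)"
      unfolding sum.reindex[OF inj] o_def
      by (intro sum.cong refl) (simp only: placementD(2)[OF pos g subsetD[OF V]])
    also have "\<dots> = (\<Sum>v\<in>\<sigma>. \<Sum>u\<in>verts M. if ?a u = w then pos v u else 0)"
      by (intro sum.cong refl affine_ext_sum[OF finM supp])
    also have "\<dots> = (\<Sum>u\<in>verts M. \<Sum>v\<in>\<sigma>. if ?a u = w then pos v u else 0)"
      by (rule sum.swap)
    finally have "average pos (vact K g ` \<sigma>) w =
        (\<Sum>u\<in>verts M. (\<Sum>v\<in>\<sigma>. if ?a u = w then pos v u else 0) / real (card \<sigma>))"
      unfolding average_def card_image[OF inj] by (simp add: sum_divide_distrib)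
    also have "\<dots> = (\<Sum>u\<in>verts M. if ?a u = w then average pos \<sigma> u else 0)"
      unfolding average_def by (intro sum.cong refl) simp
    also have "\<dots> = affine_ext ?a (average pos \<sigma>) w"
    proof (rule affine_ext_sum[OF finM, symmetric])
      show "{u. average pos \<sigma> u \<noteq> 0} \<subseteq> verts M"
      proof
        fix u assume "u \<in> {u. average pos \<sigma> u \<noteq> 0}"
        then have "(\<Sum>v\<in>\<sigma>. pos v u) \<noteq> 0"
          by (auto simp: average_def)
        then obtain v where "v \<in> \<sigma>" "pos v u \<noteq> 0"
          by (meson sum.neutral)
        then show "u \<in> verts M"
          using supp by blast
      qed
    qed
    finally show ?thesis .
  qed
  then show "(average pos \<circ> inv_into (simps K) e) (vact sd g m) =
      affine_ext ?a ((average pos \<circ> inv_into (simps K) e) m)"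
    unfolding \<sigma>(2) vact_sd[OF \<sigma>(1)] o_def decode[OF \<sigma>(1)]
      decode[OF G_complex_image_simp[OF K_complex g \<sigma>(1)]] by (rule ext)
qed

text \<open>Two vertices of a simplex of the subdivision code nested simplices of \<open>K\<close>,
  so \<open>average_contraction\<close> applies in each coordinate.\<close>

lemma mesh_le_sd:
  assumes mesh: "mesh_le K pos D" and N: "\<And>\<sigma>. \<sigma> \<in> simps K \<Longrightarrow> card \<sigma> \<le> N"
  shows "mesh_le sd (average pos \<circ> inv_into (simps K) e) ((1 - 1 / real N) * D)"
  unfolding mesh_le_def
proof (intro ballI allI)
  fix s m m' u assume s: "s \<in> simps sd" and m: "m \<in> s" "m' \<in> s"
  obtain C where C: "s = e ` C" "C \<subseteq> simps K" "chain_subset C"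
    using s unfolding simps_sd by blast
  obtain \<sigma> \<tau> where C_mem: "\<sigma> \<in> C" "\<tau> \<in> C" and "m = e \<sigma>" "m' = e \<tau>"
    using m unfolding C(1) by blast
  then have st: "\<sigma> \<in> simps K" "\<tau> \<in> simps K" "m = e \<sigma>" "m' = e \<tau>" "\<sigma> \<subseteq> \<tau> \<or> \<tau> \<subseteq> \<sigma>"
    using subsetD[OF C(2)] C(3) by (simp_all add: chain_subset_def)
  have le: "\<bar>average pos \<rho> u - average pos \<rho>' u\<bar> \<le> (1 - 1 / real N) * D"
    if \<rho>: "\<rho> \<in> simps K" "\<rho>' \<in> simps K" "\<rho> \<subseteq> \<rho>'" for \<rho> \<rho>'
  proof -
    obtain v where v: "v \<in> \<rho>"
      using G_complex_simplexD(2)[OF K_complex \<rho>(1)] by blast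
    show ?thesis
      unfolding average_def
      using G_complex_simplexD(1)[OF K_complex \<rho>(2)] N[OF \<rho>(2)] \<rho>(3) v
      by (rule average_contraction) (use mesh \<rho>(2) in \<open>simp add: mesh_le_def\<close>)
  qed
  have "\<bar>average pos \<sigma> u - average pos \<tau> u\<bar> \<le> (1 - 1 / real N) * D"
    using st(5) le[OF st(1,2)] le[OF st(2,1)] by (auto simp: abs_minus_commute)
  then show "\<bar>(average pos \<circ> inv_into (simps K) e) m u - (average pos \<circ> inv_into (simps K) e) m' u\<bar>
      \<le> (1 - 1 / real N) * D"
    using st by (simp add: decode)
qed

text \<open>Members of a chain have distinct cardinalities between 1 and \<open>N\<close>. Thus
  \<open>N\<close>, and with it the contraction factor, stays the same throughout the
  iteration.\<close>

lemma card_simps_sd: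
  assumes N: "\<And>\<sigma>. \<sigma> \<in> simps K \<Longrightarrow> card \<sigma> \<le> N" and s: "s \<in> simps sd"
  shows "card s \<le> N"
proof -
  obtain C where C: "s = e ` C" "C \<subseteq> simps K" "chain_subset C"
    using s unfolding simps_sd by blast
  have fin: "finite \<sigma>" and sC: "\<sigma> \<noteq> {}" if "\<sigma> \<in> C" for \<sigma>
    using G_complex_simplexD(1,2)[OF K_complex subsetD[OF C(2) that]] by blast+
  have "inj_on card C"
  proof (rule inj_onI)
    fix \<sigma> \<tau> assume st: "\<sigma> \<in> C" "\<tau> \<in> C" "card \<sigma> = card \<tau>"
    then have "\<sigma> \<subseteq> \<tau> \<or> \<tau> \<subseteq> \<sigma>"
      using C(3) unfolding chain_subset_def by blast
    then show "\<sigma> = \<tau>"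
      using card_subset_eq[OF fin[OF st(1)]] card_subset_eq[OF fin[OF st(2)]] st(3) by metis
  qed
  moreover have "card ` C \<subseteq> {1..N}"
  proof
    fix i assume "i \<in> card ` C"
    then obtain \<sigma> where \<sigma>: "\<sigma> \<in> C" "i = card \<sigma>"
      by blast
    then show "i \<in> {1..N}"
      using fin[OF \<sigma>(1)] sC[OF \<sigma>(1)] N[OF subsetD[OF C(2) \<sigma>(1)]]
      by (simp add: Suc_le_eq card_gt_0_iff)
  qed
  ultimately have "card C \<le> card {1..N}"
    by (rule card_inj_on_le) simp
  moreover have "card s \<le> card C"
    unfolding C(1) by (rule card_image_le[OF finite_subset[OF C(2) K_finite]])
  ultimately show ?thesis
    by simp
qed

end

section \<open>Iterating the subdivision until the mesh is small\<close>

lemma gspace_map_compose: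
  assumes "gspace_map G X Y f" "gspace_map G Y Z h"
  shows "gspace_map G X Z (h \<circ> f)"
proof -
  have "f x \<in> topspace (space_top Y)" if "x \<in> topspace (space_top X)" for x
    using assms(1) that unfolding gspace_map_def by (metis continuous_map_image_subset_topspace image_subset_iff)
  then show ?thesis
    using assms by (auto simp: gspace_map_def equivariant_on_def intro: continuous_map_compose)
qed

text \<open>
  Encoding each subdivision by an injection of its finitely many vertices into \<open>nat\<close> makes the
  iteration an induction over complexes of a single type.
\<close>

lemma iterated_subdivision:
  fixes K :: "('g, 'v) gcomplex"
  assumes G: "group G" and K: "finite_free_G_complex G K"
    and N: "\<And>\<sigma>. \<sigma> \<in> simps K \<Longrightarrow> card \<sigma> \<le> N"
  shows "\<exists>(L :: ('g, nat) gcomplex) pos. finite_free_G_complex G L \<and>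
           (\<exists>f. gspace_map G (realization_gspace K) (realization_gspace L) f) \<and>
           placement G K L pos \<and> mesh_le L pos ((1 - 1 / real N) ^ Suc r) \<and>
           (\<forall>\<sigma>\<in>simps L. card \<sigma> \<le> N)"
proof -
  have Kc: "G_complex G K" "finite (simps K)"
    using K by (simp_all add: finite_free_G_complex_def)
  show ?thesis
  proof (induction r)
    \<comment> \<open>The base case already subdivides once, in order to pass from the vertex type
      of \<open>K\<close> to \<open>nat\<close>; hence the exponent \<open>Suc r\<close>. Unit
      vectors give the initial mesh 1.\<close>
    case 0
    obtain e :: "'v set \<Rightarrow> nat" where e: "inj_on e (simps K)"
      using finite_imp_inj_to_nat_seg[OF Kc(2)] by blast
    interpret coded_complex G K e
      by (simp add: coded_complex_def coded_complex_axioms_def G K e)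
    have "mesh_le K (\<lambda>v u. if u = v then 1 else 0) 1"
      by (auto simp: mesh_le_def)
    from mesh_le_sd[OF this N] show ?case
      using free_sd gspace_map_sd placement_sd[OF Kc placement_unit[OF G Kc(1)]] card_simps_sd[OF N]
      by (intro exI[of _ sd] conjI ballI
          exI[of _ "average (\<lambda>v u. if u = v then 1 else 0) \<circ> inv_into (simps K) e"])
        (auto simp del: o_apply)
  next
    case (Suc r)
    then obtain L :: "('g, nat) gcomplex" and pos f where L: "finite_free_G_complex G L"
      and f: "gspace_map G (realization_gspace K) (realization_gspace L) f"
      and pos: "placement G K L pos" and mesh: "mesh_le L pos ((1 - 1 / real N) ^ Suc r)"
      and NL: "\<And>\<sigma>. \<sigma> \<in> simps L \<Longrightarrow> card \<sigma> \<le> N"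
      by auto
    have "finite (simps L)"
      using L by (simp add: finite_free_G_complex_def)
    then obtain e :: "nat set \<Rightarrow> nat" where e: "inj_on e (simps L)"
      using finite_imp_inj_to_nat_seg by blast
    interpret coded_complex G L e
      by (simp add: coded_complex_def coded_complex_axioms_def G L e)
    obtain h where "gspace_map G (realization_gspace L) (realization_gspace sd) h"
      using gspace_map_sd by blast
    then have "gspace_map G (realization_gspace K) (realization_gspace sd) (h \<circ> f)"
      by (rule gspace_map_compose[OF f])
    then show ?case
      using free_sd placement_sd[OF Kc pos] mesh_le_sd[OF mesh NL] card_simps_sd[OF NL]
      by (intro exI[of _ sd] exI[of _ "average pos \<circ> inv_into (simps L) e"] conjI ballI)
        (auto simp del: o_apply)
  qed
qed

lemma fine_subdivision:
  fixes K :: "('g, 'v) gcomplex"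
  assumes G: "group G" and K: "finite_free_G_complex G K" and \<epsilon>: "0 < \<epsilon>"
  obtains L :: "('g, nat) gcomplex" and pos f where "finite_free_G_complex G L"
    "gspace_map G (realization_gspace K) (realization_gspace L) f"
    "placement G K L pos" "mesh_le L pos \<epsilon>"
proof -
  \<comment> \<open>Adding 1 keeps \<open>N\<close> positive for an empty complex, so that the
    contraction factor is strictly below 1.\<close>
  define N where "N = card (verts K) + 1"
  have "finite (verts K)"
    using K G_complex_simplexD(1)[of G K] by (auto simp: finite_free_G_complex_def)
  then have N: "card \<sigma> \<le> N" if "\<sigma> \<in> simps K" for \<sigma>
    unfolding N_def using card_mono[OF _ Union_upper[OF that]] by simp
  have "0 \<le> 1 - 1 / real N" "1 - 1 / real N < 1"
    by (simp_all add: N_def)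
  then obtain r where r: "(1 - 1 / real N) ^ r < \<epsilon>"
    using real_arch_pow_inv[OF \<epsilon>] by blast
  have "(1 - 1 / real N) ^ Suc r \<le> (1 - 1 / real N) ^ r"
    using \<open>0 \<le> 1 - 1 / real N\<close> by (intro power_decreasing) auto
  with r have "(1 - 1 / real N) ^ Suc r \<le> \<epsilon>"
    by linarith
  then show ?thesis
    using iterated_subdivision[OF G K N, of r] that unfolding mesh_le_def by (meson order_trans)
qed

section \<open>Index and cross-index\<close>

text \<open>The l1 distance over the vertices. For a finite complex it is continuous in the product
  topology and separates the points of the realization, as the function \<open>d\<close> of
  \<open>uniform_oscillation\<close> must.\<close>

definition vertex_dist :: "('g, 'v) gcomplex \<Rightarrow> ('v \<Rightarrow> real) \<Rightarrow> ('v \<Rightarrow> real) \<Rightarrow> real" where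
  "vertex_dist K x y = (\<Sum>v\<in>verts K. \<bar>x v - y v\<bar>)"

lemma vertex_dist_nonneg: "0 \<le> vertex_dist K x y"
  unfolding vertex_dist_def by (simp add: sum_nonneg)

lemma vertex_dist_pos:
  assumes "finite (verts K)" "x \<in> realization (simps K)" "y \<in> realization (simps K)" "x \<noteq> y"
  shows "0 < vertex_dist K x y"
proof -
  obtain v where v: "x v \<noteq> y v"
    using assms(4) by blast
  then have "x v \<noteq> 0 \<or> y v \<noteq> 0"
    by auto
  then have "v \<in> verts K"
    using realization_support[OF assms(2)] realization_support[OF assms(3)] by blast
  then show ?thesis
    unfolding vertex_dist_def using assms(1) v by (intro sum_pos2[of _ v]) auto
qed

lemma vertex_dist_mesh:
  assumes "mesh_le L pos \<epsilon>" "\<sigma> \<in> simps L" "v \<in> \<sigma>" "w \<in> \<sigma>"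
  shows "vertex_dist K (pos v) (pos w) \<le> real (card (verts K)) * \<epsilon>"
proof -
  have "vertex_dist K (pos v) (pos w) \<le> (\<Sum>_\<in>verts K. \<epsilon>)"
    unfolding vertex_dist_def by (rule sum_mono) (use assms in \<open>auto simp: mesh_le_def\<close>)
  then show ?thesis
    by simp
qed

lemma continuous_on_vertex_dist:
  assumes "continuous_on S f" "continuous_on S h"
  shows "continuous_on S (\<lambda>p. vertex_dist K (f p) (h p))"
  unfolding vertex_dist_def
  by (intro continuous_intros continuous_on_product_then_coordinatewise[OF assms(1)]
      continuous_on_product_then_coordinatewise[OF assms(2)])

lemma finite_free_G_complexD:
  assumes "finite_free_G_complex G K"
  shows "G_complex G K" "finite (simps K)" "finite (verts K)"
proof -
  show K: "G_complex G K" "finite (simps K)"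
    using assms by (simp_all add: finite_free_G_complex_def)
  show "finite (verts K)"
    using K(2) G_complex_simplexD(1)[OF K(1)] by blast
qed

lemma placement_image:
  assumes "placement G K L pos" "g \<in> carrier G" "\<sigma> \<in> simps L"
  shows "pos ` vact L g ` \<sigma> = affine_ext (vact K g) ` pos ` \<sigma>"
  unfolding image_image
  by (intro image_cong refl placementD(2)[OF assms(1,2)] UnionI[OF assms(3)])

text \<open>The cells are the finite sets of placed vertices, so \<open>f\<close> is tested only at
  those points. The bound \<epsilon> comes from the compactness of the realization of
  \<open>K\<close> and is chosen before \<open>L\<close>.\<close>

lemma cross_map_of_fine_placement:
  fixes K :: "('g, 'v) gcomplex"
  assumes G: "group G" "finite (carrier G)" and K: "finite_free_G_complex G K"
    and f: "gspace_map G (realization_gspace K) (E_gspace G k) f"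
  shows "\<exists>\<epsilon>>0. \<forall>(L :: ('g, 'w) gcomplex) pos.
           G_complex G L \<and> placement G K L pos \<and> mesh_le L pos \<epsilon> \<longrightarrow>
           (\<exists>\<phi>. gposet_map G (face_gposet L) (Q_gposet G k) \<phi>)"
proof -
  let ?S = "realization (simps K)"
  note Kc = finite_free_G_complexD[OF K]
  define d where "d = (\<lambda>(x, y). vertex_dist K x y)"
  have "continuous_on (?S \<times> ?S) d"
    unfolding d_def split_beta by (intro continuous_on_vertex_dist continuous_intros)
  moreover have "0 < d (x, y)" if "x \<in> ?S" "y \<in> ?S" "x \<noteq> y" for x y
    unfolding d_def using vertex_dist_pos[OF Kc(3) that] by simp
  ultimately obtain \<delta> where \<delta>: "0 < \<delta>" "\<And>x y u. x \<in> ?S \<Longrightarrow> y \<in> ?S \<Longrightarrow> d (x, y) < \<delta> \<Longrightarrow>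
      \<bar>f x u - f y u\<bar> < 1 / (real k + 1)"
    using uniform_oscillation_E[OF G(2) _
        compact_realization[OF Kc(2) G_complex_simplicial[OF Kc(1)]] f, of d]
    by auto
  \<comment> \<open>A distance sums one coordinate difference of at most \<epsilon> per vertex; the
    added 1 makes the total strictly less than \<delta>.\<close>
  define \<epsilon> where "\<epsilon> = \<delta> / (real (card (verts K)) + 1)"
  have "0 < \<epsilon>"
    using \<delta>(1) by (simp add: \<epsilon>_def)
  moreover have small: "real (card (verts K)) * \<epsilon> < \<delta>"
    using \<delta>(1) by (simp add: \<epsilon>_def field_simps)
  moreover have "\<exists>\<phi>. gposet_map G (face_gposet L) (Q_gposet G k) \<phi>"
    if L: "G_complex G L" and pos: "placement G K L pos" and mesh: "mesh_le L pos \<epsilon>"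
    for L :: "('g, 'w) gcomplex" and pos
  proof (rule cross_map_of_small_oscillation[OF G(1) f, where cell = "(`) pos"])
    have pS: "pos v \<in> ?S" if "\<sigma> \<in> simps L" "v \<in> \<sigma>" for \<sigma> v
      by (rule placement_in_realization[OF pos UnionI[OF that]])
    show "pos ` \<sigma> \<subseteq> topspace (space_top (realization_gspace K))" if "\<sigma> \<in> elems (face_gposet L)" for \<sigma>
      using pS that by (auto simp: face_gposet_def)
    show "pos ` \<sigma> \<noteq> {}" if "\<sigma> \<in> elems (face_gposet L)" for \<sigma>
      using G_complex_simplexD(2)[OF L] that by (simp add: face_gposet_def)
    show "pos ` \<sigma> \<subseteq> pos ` \<tau>" if "le (face_gposet L) \<sigma> \<tau>" for \<sigma> \<tau>
      using that by (auto simp: face_gposet_def)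
    show "pact (face_gposet L) g \<sigma> \<in> elems (face_gposet L)"
      if "g \<in> carrier G" "\<sigma> \<in> elems (face_gposet L)" for g \<sigma>
      using G_complex_image_simp[OF L that(1)] that(2) by (simp add: face_gposet_def)
    show "pos ` pact (face_gposet L) g \<sigma> = sact (realization_gspace K) g ` pos ` \<sigma>"
      if "g \<in> carrier G" "\<sigma> \<in> elems (face_gposet L)" for g \<sigma>
      using placement_image[OF pos that(1)] that(2) by (simp add: face_gposet_def)
    show "\<bar>f x u - f y u\<bar> < 1 / (real k + 1)"
      if \<sigma>: "\<sigma> \<in> elems (face_gposet L)" and x: "x \<in> pos ` \<sigma>" and y: "y \<in> pos ` \<sigma>" for \<sigma> x y u
    proof -
      have \<sigma>L: "\<sigma> \<in> simps L"
        using \<sigma> by (simp add: face_gposet_def)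
      obtain v w where vw: "v \<in> \<sigma>" "x = pos v" "w \<in> \<sigma>" "y = pos w"
        using x y by blast
      show ?thesis
        unfolding vw(2,4)
        by (rule \<delta>(2)[OF pS[OF \<sigma>L vw(1)] pS[OF \<sigma>L vw(3)]])
          (use vertex_dist_mesh[OF mesh \<sigma>L vw(1,3), of K] small in \<open>simp add: d_def\<close>)
    qed
  qed
  ultimately show ?thesis
    by blast
qed

text \<open>The cell of a pair of simplices is the product of the two placed vertex sets, so that
  cells are indexed by the product poset itself.\<close>

lemma cross_map_of_fine_placement_prod:
  fixes K1 :: "('g, 'v1) gcomplex" and K2 :: "('g, 'v2) gcomplex"
  assumes G: "group G" "finite (carrier G)"
    and K1: "finite_free_G_complex G K1" and K2: "finite_free_G_complex G K2"
    and f: "gspace_map G (prod_gspace (realization_gspace K1) (realization_gspace K2)) (E_gspace G k) f"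
  shows "\<exists>\<epsilon>>0. \<forall>(L1 :: ('g, 'w1) gcomplex) (L2 :: ('g, 'w2) gcomplex) pos1 pos2.
           G_complex G L1 \<and> placement G K1 L1 pos1 \<and> mesh_le L1 pos1 \<epsilon> \<and>
           G_complex G L2 \<and> placement G K2 L2 pos2 \<and> mesh_le L2 pos2 \<epsilon> \<longrightarrow>
           (\<exists>\<phi>. gposet_map G (prod_gposet (face_gposet L1) (face_gposet L2)) (Q_gposet G k) \<phi>)"
proof -
  let ?S1 = "realization (simps K1)" and ?S2 = "realization (simps K2)"
  let ?S = "?S1 \<times> ?S2" and ?X = "prod_gspace (realization_gspace K1) (realization_gspace K2)"
  note K1c = finite_free_G_complexD[OF K1] and K2c = finite_free_G_complexD[OF K2]
  \<comment> \<open>Distinct pairs differ in at least one factor, so the sum of the two distances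
    separates points.\<close>
  define d where "d = (\<lambda>(x, y). vertex_dist K1 (fst x) (fst y) + vertex_dist K2 (snd x) (snd y))"
  have top: "space_top ?X = top_of_set ?S"
    by (simp add: prod_gspace_def)
  have comp: "compact ?S"
    by (intro compact_Times compact_realization K1c K2c G_complex_simplicial[OF K1c(1)]
        G_complex_simplicial[OF K2c(1)])
  have "continuous_on (?S \<times> ?S) d"
    unfolding d_def split_beta by (intro continuous_on_vertex_dist continuous_intros)
  moreover have "0 < d (x, y)" if "x \<in> ?S" "y \<in> ?S" "x \<noteq> y" for x y
  proof (cases "fst x = fst y")
    case True
    then have "0 < vertex_dist K2 (snd x) (snd y)"
      using that by (intro vertex_dist_pos K2c) (auto simp: prod_eq_iff)
    then show ?thesis
      unfolding d_def using vertex_dist_nonneg[of K1 "fst x" "fst y"] by simp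
  next
    case False
    then have "0 < vertex_dist K1 (fst x) (fst y)"
      using that by (intro vertex_dist_pos K1c) auto
    then show ?thesis
      unfolding d_def using vertex_dist_nonneg[of K2 "snd x" "snd y"] by simp
  qed
  ultimately obtain \<delta> where \<delta>: "0 < \<delta>" "\<And>x y u. x \<in> ?S \<Longrightarrow> y \<in> ?S \<Longrightarrow> d (x, y) < \<delta> \<Longrightarrow>
      \<bar>f x u - f y u\<bar> < 1 / (real k + 1)"
    using uniform_oscillation_E[OF G(2) top comp f, of d] by blast
  define \<epsilon> where "\<epsilon> = \<delta> / (real (card (verts K1)) + real (card (verts K2)) + 1)"
  have "0 < \<epsilon>"
    using \<delta>(1) by (simp add: \<epsilon>_def)
  moreover have small: "real (card (verts K1)) * \<epsilon> + real (card (verts K2)) * \<epsilon> < \<delta>"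
    unfolding distrib_right[symmetric] using \<delta>(1) by (simp add: \<epsilon>_def pos_divide_less_eq)
  moreover have "\<exists>\<phi>. gposet_map G (prod_gposet (face_gposet L1) (face_gposet L2)) (Q_gposet G k) \<phi>"
    if L1: "G_complex G L1" and pos1: "placement G K1 L1 pos1" and mesh1: "mesh_le L1 pos1 \<epsilon>"
      and L2: "G_complex G L2" and pos2: "placement G K2 L2 pos2" and mesh2: "mesh_le L2 pos2 \<epsilon>"
    for L1 :: "('g, 'w1) gcomplex" and L2 :: "('g, 'w2) gcomplex" and pos1 pos2
  proof (rule cross_map_of_small_oscillation[OF G(1) f,
        where cell = "\<lambda>(\<sigma>, \<tau>). pos1 ` \<sigma> \<times> pos2 ` \<tau>"])
    let ?P = "prod_gposet (face_gposet L1) (face_gposet L2)"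
    let ?cell = "\<lambda>(\<sigma>, \<tau>). pos1 ` \<sigma> \<times> pos2 ` \<tau>"
    have elems: "elems ?P = simps L1 \<times> simps L2"
      by (simp add: prod_gposet_def face_gposet_def)
    have pS1: "pos1 v \<in> ?S1" if "\<sigma> \<in> simps L1" "v \<in> \<sigma>" for \<sigma> v
      by (rule placement_in_realization[OF pos1 UnionI[OF that]])
    have pS2: "pos2 v \<in> ?S2" if "\<sigma> \<in> simps L2" "v \<in> \<sigma>" for \<sigma> v
      by (rule placement_in_realization[OF pos2 UnionI[OF that]])
    show "?cell p \<subseteq> topspace (space_top ?X)" if "p \<in> elems ?P" for p
      using that pS1 pS2 by (auto simp: elems top)
    show "?cell p \<noteq> {}" if "p \<in> elems ?P" for p
      using that G_complex_simplexD(2)[OF L1, of "fst p"] G_complex_simplexD(2)[OF L2, of "snd p"]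
      by (auto simp: elems split_beta)
    show "?cell p \<subseteq> ?cell q" if "le ?P p q" for p q
      using that by (auto simp: prod_gposet_def face_gposet_def split_beta)
    show "pact ?P g p \<in> elems ?P" if "g \<in> carrier G" "p \<in> elems ?P" for g p
      using that G_complex_image_simp[OF L1] G_complex_image_simp[OF L2]
      by (auto simp: elems) (simp_all add: prod_gposet_def face_gposet_def)
    show "?cell (pact ?P g p) = sact ?X g ` ?cell p" if g: "g \<in> carrier G" and p: "p \<in> elems ?P" for g p
    proof -
      obtain \<sigma> \<tau> where st: "p = (\<sigma>, \<tau>)" "\<sigma> \<in> simps L1" "\<tau> \<in> simps L2"
        using p unfolding elems by blast
      have "?cell (pact ?P g p) = pos1 ` vact L1 g ` \<sigma> \<times> pos2 ` vact L2 g ` \<tau>"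
        by (simp add: st(1) prod_gposet_def face_gposet_def)
      also have "\<dots> = (affine_ext (vact K1 g) ` pos1 ` \<sigma>) \<times> (affine_ext (vact K2 g) ` pos2 ` \<tau>)"
        by (simp only: placement_image[OF pos1 g st(2)] placement_image[OF pos2 g st(3)])
      also have "\<dots> = sact ?X g ` ?cell p"
        by (simp add: st(1) prod_gspace_def map_prod_surj_on[unfolded map_prod_def, OF refl refl])
      finally show ?thesis .
    qed
    show "\<bar>f x u - f y u\<bar> < 1 / (real k + 1)"
      if p: "p \<in> elems ?P" and x: "x \<in> ?cell p" and y: "y \<in> ?cell p" for p x y u
    proof -
      obtain \<sigma> \<tau> where st: "p = (\<sigma>, \<tau>)" "\<sigma> \<in> simps L1" "\<tau> \<in> simps L2"
        using p unfolding elems by blast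
      obtain v w where vw: "v \<in> \<sigma>" "w \<in> \<tau>" "x = (pos1 v, pos2 w)"
        using x by (auto simp: st(1))
      obtain v' w' where vw': "v' \<in> \<sigma>" "w' \<in> \<tau>" "y = (pos1 v', pos2 w')"
        using y by (auto simp: st(1))
      have "x \<in> ?S" "y \<in> ?S"
        unfolding vw(3) vw'(3) using pS1[OF st(2)] pS2[OF st(3)] vw vw' by blast+
      moreover have "d (x, y) < \<delta>"
        using vertex_dist_mesh[OF mesh1 st(2) vw(1) vw'(1), of K1]
          vertex_dist_mesh[OF mesh2 st(3) vw(2) vw'(2), of K2] small
        by (simp add: d_def vw(3) vw'(3))
      ultimately show ?thesis
        by (rule \<delta>(2))
    qed
  qed
  ultimately show ?thesis
    by blast
qed

section \<open>Attained minima and comparison of the two indices\<close>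

text \<open>The infimum of the empty set is \<infinity>, so a finite value comes from a non-empty
  set, where it is attained by well-ordering.\<close>

lemma Inf_enat_eq_iff: "Inf {enat k | k. P k} = enat n \<longleftrightarrow> P n \<and> (\<forall>k<n. \<not> P k)"
proof
  assume L: "Inf {enat k | k. P k} = enat n"
  then have ne: "{enat k | k. P k} \<noteq> {}"
    by (metis Inf_empty enat.distinct(2) top_enat_def)
  have "Inf {enat k | k. P k} \<in> {enat k | k. P k}"
    by (rule wellorder_InfI[OF some_in_eq[THEN iffD2, OF ne]])
  then have "P n"
    unfolding L by auto
  moreover have "\<not> P k" if "k < n" for k
  proof
    assume "P k"
    then have "Inf {enat k | k. P k} \<le> enat k"
      by (intro Inf_lower) blast
    then show False
      using that unfolding L by simp
  qed
  ultimately show "P n \<and> (\<forall>k<n. \<not> P k)"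
    by blast
next
  assume R: "P n \<and> (\<forall>k<n. \<not> P k)"
  show "Inf {enat k | k. P k} = enat n"
  proof (rule antisym)
    show "Inf {enat k | k. P k} \<le> enat n"
      using R by (intro Inf_lower) blast
    show "enat n \<le> Inf {enat k | k. P k}"
      using R by (intro Inf_greatest) (auto simp: not_less[symmetric])
  qed
qed

lemma ind_eq_iff:
  "ind G X = enat n \<longleftrightarrow> (\<exists>f. gspace_map G X (E_gspace G n) f) \<and>
     (\<forall>k<n. \<nexists>f. gspace_map G X (E_gspace G k) f)"
  unfolding ind_def by (rule Inf_enat_eq_iff)

lemma xind_eq_iff:
  "xind G P = enat n \<longleftrightarrow> (\<exists>f. gposet_map G P (Q_gposet G n) f) \<and>
     (\<forall>k<n. \<nexists>f. gposet_map G P (Q_gposet G k) f)"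
  unfolding xind_def by (rule Inf_enat_eq_iff)

lemma gspace_map_fst: "gspace_map G (prod_gspace X Y) X fst"
  by (auto simp: gspace_map_def prod_gspace_def equivariant_on_def continuous_map_fst)

text \<open>A cross-map of level \<open>k < n\<close> would induce an equivariant map out of the
  realization of \<open>L\<close>, and composing it with \<open>f\<close> would contradict the index
  of \<open>K\<close>. Fineness of \<open>L\<close> enters through \<phi>, which gives the upper
  bound.\<close>

lemma xind_eq_ind_of_fine:
  fixes K :: "('g, 'v) gcomplex" and L :: "('g, 'w) gcomplex"
  assumes "group G" "finite (carrier G)" and L: "finite_free_G_complex G L"
    and f: "gspace_map G (realization_gspace K) (realization_gspace L) f"
    and n: "ind G (realization_gspace K) = enat n"
    and \<phi>: "\<exists>\<phi>. gposet_map G (face_gposet L) (Q_gposet G n) \<phi>"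
  shows "xind G (face_gposet L) = enat n"
  unfolding xind_eq_iff
proof (intro conjI allI impI notI \<phi>)
  fix k assume k: "k < n" and "\<exists>\<psi>. gposet_map G (face_gposet L) (Q_gposet G k) \<psi>"
  then obtain \<psi> where "gposet_map G (face_gposet L) (Q_gposet G k) \<psi>"
    by blast
  then obtain h where "gspace_map G (realization_gspace L) (E_gspace G k) h"
    using gspace_map_of_cross_map[OF assms(1,2) finite_free_G_complexD(1,2)[OF L]] by blast
  then have "gspace_map G (realization_gspace K) (E_gspace G k) (h \<circ> f)"
    by (rule gspace_map_compose[OF f])
  then show False
    using n k unfolding ind_eq_iff by blast
qed

lemma mesh_le_mono: "mesh_le L pos \<epsilon> \<Longrightarrow> \<epsilon> \<le> \<epsilon>' \<Longrightarrow> mesh_le L pos \<epsilon>'"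
  unfolding mesh_le_def by (meson order_trans)

theorem theorem1p8:
  fixes G :: "('g, 'm) monoid_scheme" and n :: nat
  assumes "group G" and "finite (carrier G)" and "carrier G \<noteq> {\<one>\<^bsub>G\<^esub>}"
    and "\<forall>(K1 :: ('g, nat) gcomplex) (K2 :: ('g, nat) gcomplex).
           finite_free_G_complex G K1 \<and> finite_free_G_complex G K2 \<and>
           xind G (face_gposet K1) = enat n \<and> xind G (face_gposet K2) = enat n \<longrightarrow>
           xind G (prod_gposet (face_gposet K1) (face_gposet K2)) = enat n"
  shows "\<forall>(K1 :: ('g, 'v) gcomplex) (K2 :: ('g, 'w) gcomplex).
           finite_free_G_complex G K1 \<and> finite_free_G_complex G K2 \<and>
           ind G (realization_gspace K1) = enat n \<and> ind G (realization_gspace K2) = enat n \<longrightarrow>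
           ind G (prod_gspace (realization_gspace K1) (realization_gspace K2)) = enat n"
proof (intro allI impI, elim conjE)
  fix K1 :: "('g, 'v) gcomplex" and K2 :: "('g, 'w) gcomplex"
  assume K1: "finite_free_G_complex G K1" and K2: "finite_free_G_complex G K2"
    and n1: "ind G (realization_gspace K1) = enat n" and n2: "ind G (realization_gspace K2) = enat n"
  let ?X = "prod_gspace (realization_gspace K1) (realization_gspace K2)"
  obtain f1 f2 where f1: "gspace_map G (realization_gspace K1) (E_gspace G n) f1"
    and f2: "gspace_map G (realization_gspace K2) (E_gspace G n) f2"
    using n1 n2 unfolding ind_eq_iff by blast
  show "ind G ?X = enat n"
    unfolding ind_eq_iff
  proof (intro conjI allI impI notI)
    show "\<exists>f. gspace_map G ?X (E_gspace G n) f"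
      using gspace_map_compose[OF gspace_map_fst f1] by blast
  next
    fix k assume k: "k < n" and "\<exists>f. gspace_map G ?X (E_gspace G k) f"
    then obtain f where f: "gspace_map G ?X (E_gspace G k) f"
      by blast
    obtain \<epsilon>1 where \<epsilon>1: "0 < \<epsilon>1" "\<And>(L :: ('g, nat) gcomplex) pos. G_complex G L \<Longrightarrow>
        placement G K1 L pos \<Longrightarrow> mesh_le L pos \<epsilon>1 \<Longrightarrow>
        \<exists>\<phi>. gposet_map G (face_gposet L) (Q_gposet G n) \<phi>"
      using cross_map_of_fine_placement[OF assms(1,2) K1 f1] by blast
    obtain \<epsilon>2 where \<epsilon>2: "0 < \<epsilon>2" "\<And>(L :: ('g, nat) gcomplex) pos. G_complex G L \<Longrightarrow>
        placement G K2 L pos \<Longrightarrow> mesh_le L pos \<epsilon>2 \<Longrightarrow>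
        \<exists>\<phi>. gposet_map G (face_gposet L) (Q_gposet G n) \<phi>"
      using cross_map_of_fine_placement[OF assms(1,2) K2 f2] by blast
    obtain \<epsilon>3 where \<epsilon>3: "0 < \<epsilon>3"
      "\<And>(L1 :: ('g, nat) gcomplex) (L2 :: ('g, nat) gcomplex) pos1 pos2.
        G_complex G L1 \<Longrightarrow> placement G K1 L1 pos1 \<Longrightarrow> mesh_le L1 pos1 \<epsilon>3 \<Longrightarrow>
        G_complex G L2 \<Longrightarrow> placement G K2 L2 pos2 \<Longrightarrow> mesh_le L2 pos2 \<epsilon>3 \<Longrightarrow>
        \<exists>\<phi>. gposet_map G (prod_gposet (face_gposet L1) (face_gposet L2)) (Q_gposet G k) \<phi>"
      using cross_map_of_fine_placement_prod[OF assms(1,2) K1 K2 f] by blast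
    \<comment> \<open>One mesh serves three purposes: cross-maps of level \<open>n\<close> on both
      subdivisions, and a cross-map of level \<open>k\<close> on the product of their face
      posets.\<close>
    define \<epsilon> where "\<epsilon> = min \<epsilon>1 (min \<epsilon>2 \<epsilon>3)"
    have \<epsilon>: "0 < \<epsilon>" "\<epsilon> \<le> \<epsilon>1" "\<epsilon> \<le> \<epsilon>2" "\<epsilon> \<le> \<epsilon>3"
      using \<epsilon>1(1) \<epsilon>2(1) \<epsilon>3(1) by (simp_all add: \<epsilon>_def)
    obtain L1 :: "('g, nat) gcomplex" and pos1 h1 where L1: "finite_free_G_complex G L1"
      "gspace_map G (realization_gspace K1) (realization_gspace L1) h1"
      "placement G K1 L1 pos1" "mesh_le L1 pos1 \<epsilon>"
      using fine_subdivision[OF assms(1) K1 \<epsilon>(1)] by blast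
    obtain L2 :: "('g, nat) gcomplex" and pos2 h2 where L2: "finite_free_G_complex G L2"
      "gspace_map G (realization_gspace K2) (realization_gspace L2) h2"
      "placement G K2 L2 pos2" "mesh_le L2 pos2 \<epsilon>"
      using fine_subdivision[OF assms(1) K2 \<epsilon>(1)] by blast
    note L1c = finite_free_G_complexD(1)[OF L1(1)] and L2c = finite_free_G_complexD(1)[OF L2(1)]
    have "xind G (face_gposet L1) = enat n"
      by (rule xind_eq_ind_of_fine[OF assms(1,2) L1(1,2) n1
            \<epsilon>1(2)[OF L1c L1(3) mesh_le_mono[OF L1(4) \<epsilon>(2)]]])
    moreover have "xind G (face_gposet L2) = enat n"
      by (rule xind_eq_ind_of_fine[OF assms(1,2) L2(1,2) n2
            \<epsilon>2(2)[OF L2c L2(3) mesh_le_mono[OF L2(4) \<epsilon>(3)]]])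
    ultimately have "xind G (prod_gposet (face_gposet L1) (face_gposet L2)) = enat n"
      using assms(4) L1(1) L2(1) by blast
    moreover have "\<exists>\<phi>. gposet_map G (prod_gposet (face_gposet L1) (face_gposet L2)) (Q_gposet G k) \<phi>"
      by (rule \<epsilon>3(2)[OF L1c L1(3) mesh_le_mono[OF L1(4) \<epsilon>(4)] L2c L2(3) mesh_le_mono[OF L2(4) \<epsilon>(4)]])
    ultimately show False
      using k unfolding xind_eq_iff by blast
  qed
qed

end
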